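(* Let $u\in\mathcal G(\mathbb R^n)$. The following are equivalent: (i) $u\circ A=u$ in $\mathcal G(\mathbb R^n)$ for all $A\in\mathsf{SO}(n,\widetilde{\mathbb R})$. (i') $u\circ A=u$ in $\mathcal G(\mathbb R^n)$ for all $A\in\mathsf{SO}(n,\mathbb R)$. (ii) $\xi u=0$ in $\mathcal G(\mathbb R^n)$ for all infinitesimal generators $\xi$ of $\mathsf{SO}(n,\mathbb R)$. (iii) $u$ possesses a representative $(u_\varepsilon)_\varepsilon$ such that each $u_\varepsilon$ is rotationally invariant. That is, standard rotations suffice to characterize rotational invariance of Colombeau generalized functions.
   Context: Let $I=(0,1]$; $O(\cdot)$-estimates are for $\varepsilon\to0$. $\mathcal E_M(\mathbb R^n)$ is the set of nets $(u_\varepsilon)_{\varepsilon\in I}\in C^\infty(\mathbb R^n)^I$ such that for every compact $K\subseteq\mathbb R^n$ and every multi-index $\alpha$ there is $p\in\mathbb N$ with $\sup_K|\partial^\alpha u_\varepsilon|=O(\varepsilon^{-p})$. $\mathcal N(\mathbb R^n)$ is the set of $(u_\varepsilon)_\varepsilon\in\mathcal E_M(\mathbb R^n)$ with $\sup_K|u_\varepsilon|=O(\varepsilon^k)$ for all compact $K$ and all $k\in\mathbb N$. $\mathcal G(\mathbb R^n):=\mathcal E_M(\mathbb R^n)/\mathcal N(\mathbb R^n)$ is the special Colombeau algebra; derivatives are defined on representatives. The ring of generalized numbers $\widetilde{\mathbb R}$ is the set of nets $(r_\varepsilon)_\varepsilon\in\mathbb R^I$ with $|r_\varepsilon|=O(\varepsilon^{-p})$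 for some $p$, modulo nets with $|r_\varepsilon|=O(\varepsilon^k)$ for all $k$. $\mathsf{SO}(n,\widetilde{\mathbb R})$ is the special orthogonal group over the ring $\widetilde{\mathbb R}$: $n\times n$ matrices $A$ over $\widetilde{\mathbb R}$ with $A^tA=\mathrm{Id}$ and $\det A=1$ in $\widetilde{\mathbb R}$. For $A=[(A_\varepsilon)_\varepsilon]\in\mathsf{SO}(n,\widetilde{\mathbb R})$, $u\circ A:=[(x\mapsto u_\varepsilon(A_\varepsilon x))_\varepsilon]\in\mathcal G(\mathbb R^n)$ (well defined). The infinitesimal generators of $\mathsf{SO}(n,\mathbb R)$ are the vector fields $x_i\partial_{x_j}-x_j\partial_{x_i}$, $1\le i<j\le n$ (and their linear combinations). A smooth function $g$ on $\mathbb R^n$ is rotationally invariant if $g\circ A=g$ for all $A\in\mathsf{SO}(n,\mathbb R)$. *)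

theory Defs
  imports "HOL-Analysis.Analysis" "HOL-Library.Landau_Symbols"
begin

text \<open>
  Nets indexed by \<open>I = (0,1]\<close> are functions on \<open>real\<close> of which only the values on \<open>{0<..1}\<close> matter;
  estimates for \<open>\<epsilon> \<rightarrow> 0\<close> are taken along \<open>at_right 0\<close>.
\<close>

section \<open>Generalized numbers\<close>

definition moderate_real :: "(real \<Rightarrow> real) set" where
  "moderate_real = {r. \<exists>p::nat. r \<in> O[at_right 0](\<lambda>\<epsilon>. 1 / \<epsilon> ^ p)}"

definition negligible_real :: "(real \<Rightarrow> real) set" where
  "negligible_real = {r. \<forall>k::nat. r \<in> O[at_right 0](\<lambda>\<epsilon>. \<epsilon> ^ k)}"

lemma eventually_small:
  assumes "0 < (d::real)"
  shows "\<forall>\<^sub>F e in at_right 0. 0 < e \<and> e \<le> 1 \<and> e \<le> d"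
proof -
  have "\<forall>\<^sub>F e in at_right (0::real). e \<in> {0<..<min 1 d}"
    by (rule eventually_at_right_real) (use assms in auto)
  then show ?thesis by eventually_elim auto
qed

lemma inverse_power_mono:
  fixes e :: real
  assumes "0 < e" "e \<le> 1" "p \<le> q"
  shows "1 / e ^ p \<le> 1 / e ^ q"
  using assms by (intro divide_left_mono power_decreasing) auto

lemma moderate_real_iff:
  "r \<in> moderate_real \<longleftrightarrow> (\<exists>p. \<forall>\<^sub>F e in at_right 0. \<bar>r e\<bar> \<le> 1 / e ^ p)"
proof
  assume "r \<in> moderate_real"
  then obtain p where "r \<in> O[at_right 0](\<lambda>e. 1 / e ^ p)"
    by (auto simp: moderate_real_def)
  then obtain c where c: "c > 0" "\<forall>\<^sub>F e in at_right 0. norm (r e) \<le> c * norm (1 / e ^ p)"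
    by (auto elim: landau_o.bigE)
  have c': "0 < 1 / c" using c by simp
  have "\<forall>\<^sub>F e in at_right 0. \<bar>r e\<bar> \<le> 1 / e ^ Suc p"
    using c(2) eventually_small[OF c']
  proof eventually_elim
    case (elim e)
    have "c \<le> 1 / e" using elim c by (simp add: field_simps)
    then have "c * (1 / e ^ p) \<le> (1 / e) * (1 / e ^ p)"
      using elim c by (intro mult_right_mono) auto
    then show ?case using elim c by simp
  qed
  then show "\<exists>p. \<forall>\<^sub>F e in at_right 0. \<bar>r e\<bar> \<le> 1 / e ^ p" by blast
next
  assume "\<exists>p. \<forall>\<^sub>F e in at_right 0. \<bar>r e\<bar> \<le> 1 / e ^ p"
  then obtain p where p: "\<forall>\<^sub>F e in at_right 0. \<bar>r e\<bar> \<le> 1 / e ^ p" by blast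
  have "r \<in> O[at_right 0](\<lambda>e. 1 / e ^ p)"
  proof (rule landau_o.bigI[of 1])
    show "\<forall>\<^sub>F e in at_right 0. norm (r e) \<le> 1 * norm (1 / e ^ p)"
      using p eventually_small[of 1, simplified] by eventually_elim simp
  qed simp
  then show "r \<in> moderate_real" by (auto simp: moderate_real_def)
qed

lemma negligible_real_iff:
  "r \<in> negligible_real \<longleftrightarrow> (\<forall>k. \<forall>\<^sub>F e in at_right 0. \<bar>r e\<bar> \<le> e ^ k)"
proof
  assume r: "r \<in> negligible_real"
  show "\<forall>k. \<forall>\<^sub>F e in at_right 0. \<bar>r e\<bar> \<le> e ^ k"
  proof
    fix k
    have "r \<in> O[at_right 0](\<lambda>e. e ^ Suc k)"
      using r unfolding negligible_real_def by blast
    then obtain c where c: "c > 0" "\<forall>\<^sub>F e in at_right 0. norm (r e) \<le> c * norm (e ^ Suc k)"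
      by (auto elim: landau_o.bigE)
    have c': "0 < 1 / c" using c by simp
    show "\<forall>\<^sub>F e in at_right 0. \<bar>r e\<bar> \<le> e ^ k"
      using c(2) eventually_small[OF c']
    proof eventually_elim
      case (elim e)
      have "c * e \<le> 1" using elim c by (simp add: field_simps)
      then have "(c * e) * e ^ k \<le> 1 * e ^ k"
        using elim c by (intro mult_right_mono) auto
      moreover have "\<bar>r e\<bar> \<le> c * e * e ^ k" using elim by (simp add: abs_mult mult.assoc)
      ultimately show ?case by linarith
    qed
  qed
next
  assume r: "\<forall>k. \<forall>\<^sub>F e in at_right 0. \<bar>r e\<bar> \<le> e ^ k"
  have "r \<in> O[at_right 0](\<lambda>e. e ^ k)" for k
  proof (rule landau_o.bigI[of 1])
    show "\<forall>\<^sub>F e in at_right 0. norm (r e) \<le> 1 * norm (e ^ k)"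
      using r[rule_format, of k] eventually_small[of 1, simplified] by eventually_elim simp
  qed simp
  then show "r \<in> negligible_real" by (auto simp: negligible_real_def)
qed

lemma double_le_inverse_power:
  fixes e :: real
  assumes "0 < e" "e \<le> 1 / 2"
  shows "1 / e ^ p + 1 / e ^ q \<le> 1 / e ^ Suc (p + q)"
proof -
  have "1 / e ^ p \<le> 1 / e ^ (p + q)" "1 / e ^ q \<le> 1 / e ^ (p + q)"
    using assms by (auto intro!: inverse_power_mono)
  moreover have "2 * (1 / e ^ (p + q)) \<le> (1 / e) * (1 / e ^ (p + q))"
    using assms by (intro mult_right_mono) (auto simp: field_simps)
  ultimately show ?thesis by simp
qed

lemma double_le_power:
  fixes e :: real
  assumes "0 < e" "e \<le> 1 / 2"
  shows "e ^ Suc k + e ^ Suc k \<le> e ^ k"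
  using assms mult_right_mono[of "2 * e" 1 "e ^ k"] by simp

lemma moderate_real_add: "r \<in> moderate_real \<Longrightarrow> s \<in> moderate_real \<Longrightarrow> (\<lambda>e. r e + s e) \<in> moderate_real"
  unfolding moderate_real_iff
proof (elim exE)
  fix p q assume a: "\<forall>\<^sub>F e in at_right 0. \<bar>r e\<bar> \<le> 1 / e ^ p" "\<forall>\<^sub>F e in at_right 0. \<bar>s e\<bar> \<le> 1 / e ^ q"
  have "\<forall>\<^sub>F e in at_right 0. \<bar>r e + s e\<bar> \<le> 1 / e ^ Suc (p + q)"
    using a eventually_small[of "1 / 2", simplified]
  proof eventually_elim
    case (elim e)
    then show ?case using double_le_inverse_power[of e p q] by linarith
  qed
  then show "\<exists>p. \<forall>\<^sub>F e in at_right 0. \<bar>r e + s e\<bar> \<le> 1 / e ^ p" by blast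
qed

lemma moderate_real_mult: "r \<in> moderate_real \<Longrightarrow> s \<in> moderate_real \<Longrightarrow> (\<lambda>e. r e * s e) \<in> moderate_real"
  unfolding moderate_real_iff
proof (elim exE)
  fix p q assume a: "\<forall>\<^sub>F e in at_right 0. \<bar>r e\<bar> \<le> 1 / e ^ p" "\<forall>\<^sub>F e in at_right 0. \<bar>s e\<bar> \<le> 1 / e ^ q"
  have "\<forall>\<^sub>F e in at_right 0. \<bar>r e * s e\<bar> \<le> 1 / e ^ (p + q)"
    using a eventually_small[of 1, simplified]
  proof eventually_elim
    case (elim e)
    then have "\<bar>r e\<bar> * \<bar>s e\<bar> \<le> (1 / e ^ p) * (1 / e ^ q)" by (intro mult_mono) auto
    then show ?case by (simp add: abs_mult power_add)
  qed
  then show "\<exists>p. \<forall>\<^sub>F e in at_right 0. \<bar>r e * s e\<bar> \<le> 1 / e ^ p" by blast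
qed

lemma moderate_real_const [simp]: "(\<lambda>_. c) \<in> moderate_real"
  unfolding moderate_real_def by (auto intro!: exI[of _ 0])

lemma moderate_real_minus: "r \<in> moderate_real \<Longrightarrow> (\<lambda>e. - r e) \<in> moderate_real"
  by (simp add: moderate_real_iff)

lemma moderate_real_sum: "(\<And>i. i \<in> A \<Longrightarrow> r i \<in> moderate_real) \<Longrightarrow> (\<lambda>e. \<Sum>i\<in>A. r i e) \<in> moderate_real"
  by (induction A rule: infinite_finite_induct) (auto intro: moderate_real_add)

lemma negligible_real_add: "r \<in> negligible_real \<Longrightarrow> s \<in> negligible_real \<Longrightarrow> (\<lambda>e. r e + s e) \<in> negligible_real"
  unfolding negligible_real_iff
proof
  fix k assume a: "\<forall>k. \<forall>\<^sub>F e in at_right 0. \<bar>r e\<bar> \<le> e ^ k" "\<forall>k. \<forall>\<^sub>F e in at_right 0. \<bar>s e\<bar> \<le> e ^ k"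
  show "\<forall>\<^sub>F e in at_right 0. \<bar>r e + s e\<bar> \<le> e ^ k"
    using a(1)[rule_format, of "Suc k"] a(2)[rule_format, of "Suc k"] eventually_small[of "1 / 2", simplified]
  proof eventually_elim
    case (elim e)
    then show ?case using double_le_power[of e k] by linarith
  qed
qed

lemma negligible_real_mult: "r \<in> negligible_real \<Longrightarrow> s \<in> moderate_real \<Longrightarrow> (\<lambda>e. r e * s e) \<in> negligible_real"
  unfolding negligible_real_iff moderate_real_iff
proof (elim exE, rule)
  fix k p assume a: "\<forall>k. \<forall>\<^sub>F e in at_right 0. \<bar>r e\<bar> \<le> e ^ k" "\<forall>\<^sub>F e in at_right 0. \<bar>s e\<bar> \<le> 1 / e ^ p"
  show "\<forall>\<^sub>F e in at_right 0. \<bar>r e * s e\<bar> \<le> e ^ k"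
    using a(1)[rule_format, of "k + p"] a(2) eventually_small[of 1, simplified]
  proof eventually_elim
    case (elim e)
    then have "\<bar>r e\<bar> * \<bar>s e\<bar> \<le> e ^ (k + p) * (1 / e ^ p)" by (intro mult_mono) auto
    then show ?case using elim by (simp add: abs_mult power_add)
  qed
qed

lemma negligible_real_minus: "r \<in> negligible_real \<Longrightarrow> (\<lambda>e. - r e) \<in> negligible_real"
  by (simp add: negligible_real_iff)

lemma negligible_real_0 [simp]: "(\<lambda>_. 0) \<in> negligible_real"
  by (simp add: negligible_real_def)

lemma one_not_negligible_real: "(\<lambda>_. 1) \<notin> negligible_real"
proof
  assume "(\<lambda>_. 1) \<in> negligible_real"
  then have "\<forall>\<^sub>F e in at_right 0. \<bar>1::real\<bar> \<le> e ^ 1"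
    unfolding negligible_real_iff by blast
  then have "\<forall>\<^sub>F e in at_right (0::real). False"
    using eventually_small[of "1 / 2", simplified] by eventually_elim simp
  then show False by (simp add: trivial_limit_at_right_real)
qed

definition gen_real_rel :: "(real \<Rightarrow> real) \<Rightarrow> (real \<Rightarrow> real) \<Rightarrow> bool" where
  "gen_real_rel r s \<longleftrightarrow> r \<in> moderate_real \<and> s \<in> moderate_real \<and> (\<lambda>\<epsilon>. r \<epsilon> - s \<epsilon>) \<in> negligible_real"

lemma gen_real_rel_refl: "r \<in> moderate_real \<Longrightarrow> gen_real_rel r r"
  by (simp add: gen_real_rel_def)

quotient_type gen_real = "real \<Rightarrow> real" / partial: gen_real_rel
proof (rule part_equivpI)
  show "\<exists>x. gen_real_rel x x"
    by (rule exI[of _ "\<lambda>_. 0"]) (simp add: gen_real_rel_def)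
  show "symp gen_real_rel"
  proof (rule sympI)
    fix r s assume "gen_real_rel r s"
    then show "gen_real_rel s r"
      using negligible_real_minus[of "\<lambda>e. r e - s e"] by (simp add: gen_real_rel_def)
  qed
  show "transp gen_real_rel"
  proof (rule transpI)
    fix r s t assume "gen_real_rel r s" "gen_real_rel s t"
    then show "gen_real_rel r t"
      using negligible_real_add[of "\<lambda>e. r e - s e" "\<lambda>e. s e - t e"] by (simp add: gen_real_rel_def)
  qed
qed

instantiation gen_real :: "{comm_ring_1, real_algebra_1}"
begin

lift_definition zero_gen_real :: gen_real is "\<lambda>_. 0"
  by (simp add: gen_real_rel_def)

lift_definition one_gen_real :: gen_real is "\<lambda>_. 1"
  by (simp add: gen_real_rel_def)

lift_definition plus_gen_real :: "gen_real \<Rightarrow> gen_real \<Rightarrow> gen_real" is "\<lambda>r s \<epsilon>. r \<epsilon> + s \<epsilon>"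
  unfolding gen_real_rel_def
  using moderate_real_add negligible_real_add by (fastforce simp: add_diff_add)

lift_definition uminus_gen_real :: "gen_real \<Rightarrow> gen_real" is "\<lambda>r \<epsilon>. - r \<epsilon>"
  unfolding gen_real_rel_def
  using moderate_real_minus negligible_real_minus by (fastforce simp: minus_diff_minus)

lift_definition times_gen_real :: "gen_real \<Rightarrow> gen_real \<Rightarrow> gen_real" is "\<lambda>r s \<epsilon>. r \<epsilon> * s \<epsilon>"
proof -
  fix r r' s s' assume "gen_real_rel r r'" "gen_real_rel s s'"
  then have m: "r \<in> moderate_real" "r' \<in> moderate_real" "s \<in> moderate_real" "s' \<in> moderate_real"
    and n: "(\<lambda>e. r e - r' e) \<in> negligible_real" "(\<lambda>e. s e - s' e) \<in> negligible_real"
    by (auto simp: gen_real_rel_def)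
  have "(\<lambda>e. (r e - r' e) * s e + (s e - s' e) * r' e) \<in> negligible_real"
    using m n by (intro negligible_real_add negligible_real_mult)
  also have "(\<lambda>e. (r e - r' e) * s e + (s e - s' e) * r' e) = (\<lambda>e. r e * s e - r' e * s' e)"
    by (auto simp: algebra_simps)
  finally show "gen_real_rel (\<lambda>e. r e * s e) (\<lambda>e. r' e * s' e)"
    using m by (auto simp: gen_real_rel_def intro: moderate_real_mult)
qed

definition minus_gen_real :: "gen_real \<Rightarrow> gen_real \<Rightarrow> gen_real" where
  "minus_gen_real a b = a + - b"

lift_definition scaleR_gen_real :: "real \<Rightarrow> gen_real \<Rightarrow> gen_real" is "\<lambda>c r \<epsilon>. c * r \<epsilon>"
proof -
  fix c r r' assume "gen_real_rel r r'"
  then have m: "r \<in> moderate_real" "r' \<in> moderate_real"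
    and n: "(\<lambda>e. (r e - r' e) * c) \<in> negligible_real"
    by (auto simp: gen_real_rel_def intro!: negligible_real_mult)
  then show "gen_real_rel (\<lambda>e. c * r e) (\<lambda>e. c * r' e)"
    using moderate_real_mult[OF moderate_real_const, of _ c]
    by (auto simp: gen_real_rel_def algebra_simps)
qed

instance
proof
  fix a b c :: gen_real and x y :: real
  show "a + b + c = a + (b + c)"
    by transfer (auto intro!: gen_real_rel_refl moderate_real_add simp: add.assoc gen_real_rel_def)
  show "a + b = b + a"
    by transfer (auto intro!: moderate_real_add simp: add.commute gen_real_rel_def)
  show "0 + a = a"
    by transfer (auto simp: gen_real_rel_def)
  show "- a + a = 0"
    by transfer (auto simp: gen_real_rel_def)
  show "a - b = a + - b"
    by (simp add: minus_gen_real_def)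
  show "a * b * c = a * (b * c)"
    by transfer (auto intro!: moderate_real_mult simp: mult.assoc gen_real_rel_def)
  show "a * b = b * a"
    by transfer (auto intro!: moderate_real_mult simp: mult.commute gen_real_rel_def)
  show "1 * a = a"
    by transfer (auto simp: gen_real_rel_def)
  show "(a + b) * c = a * c + b * c"
    by transfer (auto intro!: moderate_real_mult moderate_real_add simp: distrib_right gen_real_rel_def)
  show "a * (b + c) = a * b + a * c"
    by transfer (auto intro!: moderate_real_mult moderate_real_add simp: distrib_left gen_real_rel_def)
  show "a * 1 = a"
    by transfer (auto simp: gen_real_rel_def)
  show "(0::gen_real) \<noteq> 1"
    by transfer (use negligible_real_minus[of "\<lambda>_. -1"] one_not_negligible_real in \<open>auto simp: gen_real_rel_def\<close>)
  show "x *\<^sub>R (a + b) = x *\<^sub>R a + x *\<^sub>R b"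
    by transfer (auto intro!: moderate_real_mult moderate_real_add simp: distrib_left gen_real_rel_def)
  show "(x + y) *\<^sub>R a = x *\<^sub>R a + y *\<^sub>R a"
    by transfer (auto intro!: moderate_real_mult moderate_real_add simp: distrib_right gen_real_rel_def)
  show "x *\<^sub>R y *\<^sub>R a = (x * y) *\<^sub>R a"
    by transfer (auto intro!: moderate_real_mult simp: mult.assoc gen_real_rel_def)
  show "1 *\<^sub>R a = a"
    by transfer (auto simp: gen_real_rel_def)
  show "x *\<^sub>R a * b = x *\<^sub>R (a * b)"
    by transfer (auto intro!: moderate_real_mult simp: mult.assoc gen_real_rel_def)
  show "a * x *\<^sub>R b = x *\<^sub>R (a * b)"
    by transfer (auto intro!: moderate_real_mult simp: mult.left_commute gen_real_rel_def)
qed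

end

section \<open>Smooth functions\<close>

definition partial_deriv :: "'n::finite \<Rightarrow> (real^'n \<Rightarrow> real) \<Rightarrow> real^'n \<Rightarrow> real" where
  "partial_deriv i f x = frechet_derivative f (at x) (axis i 1)"

text \<open>
  A multi-index is encoded by a list of coordinates, \<open>[i\<^sub>1, \<dots>, i\<^sub>m]\<close> standing for
  \<open>\<partial>\<^bsub>i\<^sub>m\<^esub> \<dots> \<partial>\<^bsub>i\<^sub>1\<^esub>\<close>; the partial derivatives of smooth functions commute.
\<close>

definition multi_deriv :: "'n::finite list \<Rightarrow> (real^'n \<Rightarrow> real) \<Rightarrow> real^'n \<Rightarrow> real" where
  "multi_deriv is f = fold partial_deriv is f"

definition smooth :: "(real^'n::finite \<Rightarrow> real) \<Rightarrow> bool" where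
  "smooth f \<longleftrightarrow> (\<forall>is x. multi_deriv is f differentiable (at x))"

lemma multi_deriv_Nil [simp]: "multi_deriv [] f = f"
  and multi_deriv_Cons [simp]: "multi_deriv (i # is) f = multi_deriv is (partial_deriv i f)"
  by (simp_all add: multi_deriv_def)

section \<open>The special Colombeau algebra\<close>

text \<open>
  The compact sets are required to be nonempty because the supremum of the empty set of reals
  is unspecified.
\<close>

definition moderate_nets :: "(real \<Rightarrow> real^'n::finite \<Rightarrow> real) set" where
  "moderate_nets = {u. (\<forall>\<epsilon>\<in>{0<..1}. smooth (u \<epsilon>)) \<and>
     (\<forall>K is. compact K \<longrightarrow> K \<noteq> {} \<longrightarrow>
        (\<exists>p::nat. (\<lambda>\<epsilon>. SUP x\<in>K. \<bar>multi_deriv is (u \<epsilon>) x\<bar>) \<in> O[at_right 0](\<lambda>\<epsilon>. 1 / \<epsilon> ^ p)))}"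

definition negligible_nets :: "(real \<Rightarrow> real^'n::finite \<Rightarrow> real) set" where
  "negligible_nets = {u \<in> moderate_nets.
     \<forall>K. compact K \<longrightarrow> K \<noteq> {} \<longrightarrow>
        (\<forall>k::nat. (\<lambda>\<epsilon>. SUP x\<in>K. \<bar>u \<epsilon> x\<bar>) \<in> O[at_right 0](\<lambda>\<epsilon>. \<epsilon> ^ k))}"

lemma abs_SUP_le_iff:
  fixes f :: "'a::topological_space \<Rightarrow> real"
  assumes "compact K" "K \<noteq> {}" "continuous_on K f"
  shows "\<bar>SUP x\<in>K. \<bar>f x\<bar>\<bar> \<le> c \<longleftrightarrow> (\<forall>x\<in>K. \<bar>f x\<bar> \<le> (c::real))"
proof -
  have bdd: "bdd_above ((\<lambda>x. \<bar>f x\<bar>) ` K)"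
    using assms by (intro bounded_imp_bdd_above compact_imp_bounded compact_continuous_image continuous_intros)
  obtain y where "y \<in> K" using assms by blast
  then have "0 \<le> (SUP x\<in>K. \<bar>f x\<bar>)"
    using bdd by (intro cSUP_upper2[where x=y]) auto
  then show ?thesis using bdd assms(2) by (auto simp: cSUP_le_iff)
qed

definition loc_moderate :: "(real \<Rightarrow> real^'n::finite \<Rightarrow> real) \<Rightarrow> bool" where
  "loc_moderate u \<longleftrightarrow> (\<forall>K. compact K \<longrightarrow> (\<exists>p. \<forall>\<^sub>F e in at_right 0. \<forall>x\<in>K. \<bar>u e x\<bar> \<le> 1 / e ^ p))"

definition loc_negligible :: "(real \<Rightarrow> real^'n::finite \<Rightarrow> real) \<Rightarrow> bool" where
  "loc_negligible u \<longleftrightarrow> (\<forall>K. compact K \<longrightarrow> (\<forall>k. \<forall>\<^sub>F e in at_right 0. \<forall>x\<in>K. \<bar>u e x\<bar> \<le> e ^ k))"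

lemma eventually_SUP:
  fixes u :: "real \<Rightarrow> 'a::topological_space \<Rightarrow> real"
  assumes "compact K" "K \<noteq> {}" "\<forall>e\<in>{0<..1}. continuous_on UNIV (u e)"
  shows "(\<forall>\<^sub>F e in at_right 0. \<bar>SUP x\<in>K. \<bar>u e x\<bar>\<bar> \<le> c e) \<longleftrightarrow>
         (\<forall>\<^sub>F e in at_right 0. \<forall>x\<in>K. \<bar>u e x\<bar> \<le> (c e::real))"
  by (rule eventually_cong[OF eventually_small[of 1, simplified]]) (use assms in \<open>simp_all add: abs_SUP_le_iff continuous_on_subset[of UNIV]\<close>)

lemma loc_moderate_iff:
  assumes "\<forall>e\<in>{0<..1}. continuous_on UNIV (u e)"
  shows "(\<forall>K. compact K \<longrightarrow> K \<noteq> {} \<longrightarrow>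
        (\<exists>p::nat. (\<lambda>\<epsilon>. SUP x\<in>K. \<bar>u \<epsilon> x\<bar>) \<in> O[at_right 0](\<lambda>\<epsilon>. 1 / \<epsilon> ^ p))) \<longleftrightarrow> loc_moderate u"
proof -
  have "(\<exists>p::nat. (\<lambda>\<epsilon>. SUP x\<in>K. \<bar>u \<epsilon> x\<bar>) \<in> O[at_right 0](\<lambda>\<epsilon>. 1 / \<epsilon> ^ p)) \<longleftrightarrow>
      (\<exists>p. \<forall>\<^sub>F e in at_right 0. \<forall>x\<in>K. \<bar>u e x\<bar> \<le> 1 / e ^ p)" if "compact K" "K \<noteq> {}" for K
    using moderate_real_iff[of "\<lambda>e. SUP x\<in>K. \<bar>u e x\<bar>"] eventually_SUP[OF that assms]
    by (simp add: moderate_real_def)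
  note * = this
  show ?thesis unfolding loc_moderate_def
  proof (rule iff_allI)
    show "(compact K \<longrightarrow> K \<noteq> {} \<longrightarrow> (\<exists>p::nat. (\<lambda>\<epsilon>. SUP x\<in>K. \<bar>u \<epsilon> x\<bar>) \<in> O[at_right 0](\<lambda>\<epsilon>. 1 / \<epsilon> ^ p))) \<longleftrightarrow>
        (compact K \<longrightarrow> (\<exists>p. \<forall>\<^sub>F e in at_right 0. \<forall>x\<in>K. \<bar>u e x\<bar> \<le> 1 / e ^ p))" for K
      using *[of K] by (cases "K = {}") simp_all
  qed
qed

lemma loc_negligible_iff:
  assumes "\<forall>e\<in>{0<..1}. continuous_on UNIV (u e)"
  shows "(\<forall>K. compact K \<longrightarrow> K \<noteq> {} \<longrightarrow>
        (\<forall>k::nat. (\<lambda>\<epsilon>. SUP x\<in>K. \<bar>u \<epsilon> x\<bar>) \<in> O[at_right 0](\<lambda>\<epsilon>. \<epsilon> ^ k))) \<longleftrightarrow> loc_negligible u"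
proof -
  have "(\<forall>k::nat. (\<lambda>\<epsilon>. SUP x\<in>K. \<bar>u \<epsilon> x\<bar>) \<in> O[at_right 0](\<lambda>\<epsilon>. \<epsilon> ^ k)) \<longleftrightarrow>
      (\<forall>k. \<forall>\<^sub>F e in at_right 0. \<forall>x\<in>K. \<bar>u e x\<bar> \<le> e ^ k)" if "compact K" "K \<noteq> {}" for K
    using negligible_real_iff[of "\<lambda>e. SUP x\<in>K. \<bar>u e x\<bar>"] eventually_SUP[OF that assms]
    by (simp add: negligible_real_def)
  note * = this
  show ?thesis unfolding loc_negligible_def
  proof (rule iff_allI)
    show "(compact K \<longrightarrow> K \<noteq> {} \<longrightarrow> (\<forall>k::nat. (\<lambda>\<epsilon>. SUP x\<in>K. \<bar>u \<epsilon> x\<bar>) \<in> O[at_right 0](\<lambda>\<epsilon>. \<epsilon> ^ k))) \<longleftrightarrow>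
        (compact K \<longrightarrow> (\<forall>k. \<forall>\<^sub>F e in at_right 0. \<forall>x\<in>K. \<bar>u e x\<bar> \<le> e ^ k))" for K
      using *[of K] by (cases "K = {}") simp_all
  qed
qed

lemma smooth_differentiable: "smooth f \<Longrightarrow> f differentiable (at x)"
  unfolding smooth_def by (metis multi_deriv_Nil)

lemma smooth_multi_deriv: "smooth f \<Longrightarrow> smooth (multi_deriv is f)"
  unfolding smooth_def multi_deriv_def by (metis fold_append comp_apply)

lemma smooth_partial_deriv: "smooth f \<Longrightarrow> smooth (partial_deriv i f)"
  using smooth_multi_deriv[of f "[i]"] by simp

lemma smooth_continuous: "smooth f \<Longrightarrow> continuous_on S f"
  by (intro differentiable_imp_continuous_on differentiable_at_imp_differentiable_on smooth_differentiable)

lemma moderate_nets_iff: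
  "u \<in> moderate_nets \<longleftrightarrow>
     (\<forall>e\<in>{0<..1}. smooth (u e)) \<and> (\<forall>is. loc_moderate (\<lambda>e. multi_deriv is (u e)))"
proof -
  have "(\<forall>K. compact K \<longrightarrow> K \<noteq> {} \<longrightarrow>
        (\<exists>p::nat. (\<lambda>\<epsilon>. SUP x\<in>K. \<bar>multi_deriv is (u \<epsilon>) x\<bar>) \<in> O[at_right 0](\<lambda>\<epsilon>. 1 / \<epsilon> ^ p))) \<longleftrightarrow>
      loc_moderate (\<lambda>e. multi_deriv is (u e))" if "\<forall>e\<in>{0<..1}. smooth (u e)" for "is"
    using that by (intro loc_moderate_iff ballI smooth_continuous smooth_multi_deriv) simp
  then have "(\<forall>is. loc_moderate (\<lambda>e. multi_deriv is (u e))) \<longleftrightarrow>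
      (\<forall>is K. compact K \<longrightarrow> K \<noteq> {} \<longrightarrow>
        (\<exists>p::nat. (\<lambda>\<epsilon>. SUP x\<in>K. \<bar>multi_deriv is (u \<epsilon>) x\<bar>) \<in> O[at_right 0](\<lambda>\<epsilon>. 1 / \<epsilon> ^ p)))"
    if "\<forall>e\<in>{0<..1}. smooth (u e)"
    using that by simp
  then show ?thesis unfolding moderate_nets_def by blast
qed

lemma negligible_nets_iff:
  "u \<in> negligible_nets \<longleftrightarrow> u \<in> moderate_nets \<and> loc_negligible u"
proof -
  have "u \<in> moderate_nets \<Longrightarrow> \<forall>e\<in>{0<..1}. continuous_on UNIV (u e)"
    by (auto simp: moderate_nets_iff smooth_continuous)
  from loc_negligible_iff[OF this] show ?thesis
    unfolding negligible_nets_def by auto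
qed

lemma loc_moderate_cong:
  assumes "\<forall>e\<in>{0<..1}. u e = v e" "loc_moderate u"
  shows "loc_moderate v"
  unfolding loc_moderate_def
proof (intro allI impI)
  fix K :: "(real^'a) set" assume "compact K"
  then obtain p where "\<forall>\<^sub>F e in at_right 0. \<forall>x\<in>K. \<bar>u e x\<bar> \<le> 1 / e ^ p"
    using assms by (auto simp: loc_moderate_def)
  then have "\<forall>\<^sub>F e in at_right 0. \<forall>x\<in>K. \<bar>v e x\<bar> \<le> 1 / e ^ p"
    using eventually_small[of 1, simplified]
    by eventually_elim (use assms in auto)
  then show "\<exists>p. \<forall>\<^sub>F e in at_right 0. \<forall>x\<in>K. \<bar>v e x\<bar> \<le> 1 / e ^ p" by blast
qed

lemma loc_negligible_cong:
  assumes "\<forall>e\<in>{0<..1}. u e = v e" "loc_negligible u"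
  shows "loc_negligible v"
  unfolding loc_negligible_def
proof (intro allI impI)
  fix K :: "(real^'a) set" and k assume "compact K"
  then have "\<forall>\<^sub>F e in at_right 0. \<forall>x\<in>K. \<bar>u e x\<bar> \<le> e ^ k"
    using assms by (auto simp: loc_negligible_def)
  then show "\<forall>\<^sub>F e in at_right 0. \<forall>x\<in>K. \<bar>v e x\<bar> \<le> e ^ k"
    using eventually_small[of 1, simplified]
    by eventually_elim (use assms in auto)
qed

lemma loc_moderate_add:
  assumes "loc_moderate u" "loc_moderate v"
  shows "loc_moderate (\<lambda>e x. u e x + v e x)"
  unfolding loc_moderate_def
proof (intro allI impI)
  fix K :: "(real^'a) set" assume K: "compact K"
  obtain p where p: "\<forall>\<^sub>F e in at_right 0. \<forall>x\<in>K. \<bar>u e x\<bar> \<le> 1 / e ^ p"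
    using assms(1) K unfolding loc_moderate_def by blast
  obtain q where q: "\<forall>\<^sub>F e in at_right 0. \<forall>x\<in>K. \<bar>v e x\<bar> \<le> 1 / e ^ q"
    using assms(2) K unfolding loc_moderate_def by blast
  have "\<forall>\<^sub>F e in at_right 0. \<forall>x\<in>K. \<bar>u e x + v e x\<bar> \<le> 1 / e ^ Suc (p + q)"
    using p q eventually_small[of "1 / 2", simplified]
  proof eventually_elim
    case (elim e)
    show ?case
    proof
      fix x assume "x \<in> K"
      with elim have "\<bar>u e x\<bar> \<le> 1 / e ^ p" "\<bar>v e x\<bar> \<le> 1 / e ^ q" by auto
      then show "\<bar>u e x + v e x\<bar> \<le> 1 / e ^ Suc (p + q)"
        using double_le_inverse_power[of e p q] elim by linarith
    qed
  qed
  then show "\<exists>p. \<forall>\<^sub>F e in at_right 0. \<forall>x\<in>K. \<bar>u e x + v e x\<bar> \<le> 1 / e ^ p" by blast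
qed

lemma loc_moderate_mult:
  assumes "loc_moderate u" "loc_moderate v"
  shows "loc_moderate (\<lambda>e x. u e x * v e x)"
  unfolding loc_moderate_def
proof (intro allI impI)
  fix K :: "(real^'a) set" assume K: "compact K"
  obtain p where p: "\<forall>\<^sub>F e in at_right 0. \<forall>x\<in>K. \<bar>u e x\<bar> \<le> 1 / e ^ p"
    using assms(1) K unfolding loc_moderate_def by blast
  obtain q where q: "\<forall>\<^sub>F e in at_right 0. \<forall>x\<in>K. \<bar>v e x\<bar> \<le> 1 / e ^ q"
    using assms(2) K unfolding loc_moderate_def by blast
  have "\<forall>\<^sub>F e in at_right 0. \<forall>x\<in>K. \<bar>u e x * v e x\<bar> \<le> 1 / e ^ (p + q)"
    using p q eventually_small[of 1, simplified]
  proof eventually_elim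
    case (elim e)
    show ?case
    proof
      fix x assume "x \<in> K"
      with elim have "\<bar>u e x\<bar> * \<bar>v e x\<bar> \<le> (1 / e ^ p) * (1 / e ^ q)" by (intro mult_mono) auto
      then show "\<bar>u e x * v e x\<bar> \<le> 1 / e ^ (p + q)" by (simp add: abs_mult power_add)
    qed
  qed
  then show "\<exists>p. \<forall>\<^sub>F e in at_right 0. \<forall>x\<in>K. \<bar>u e x * v e x\<bar> \<le> 1 / e ^ p" by blast
qed

lemma loc_moderate_real: "r \<in> moderate_real \<Longrightarrow> loc_moderate (\<lambda>e x. r e)"
  unfolding loc_moderate_def moderate_real_iff by (auto elim!: eventually_mono)

lemma loc_moderate_const:
  assumes "continuous_on UNIV f"
  shows "loc_moderate (\<lambda>e. f)"
  unfolding loc_moderate_def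
proof (intro allI impI)
  fix K :: "(real^'a) set" assume K: "compact K"
  have "bounded (f ` K)"
    using K assms by (intro compact_imp_bounded compact_continuous_image) (auto intro: continuous_on_subset)
  then obtain c where c: "\<forall>x\<in>K. \<bar>f x\<bar> \<le> c" by (auto simp: bounded_iff)
  obtain p where "\<forall>\<^sub>F e in at_right 0. \<bar>c\<bar> \<le> 1 / e ^ p"
    using moderate_real_iff[of "\<lambda>_. c"] by auto
  then have "\<forall>\<^sub>F e in at_right 0. \<forall>x\<in>K. \<bar>f x\<bar> \<le> 1 / e ^ p"
    by eventually_elim (use c in \<open>meson abs_ge_self order_trans\<close>)
  then show "\<exists>p. \<forall>\<^sub>F e in at_right 0. \<forall>x\<in>K. \<bar>f x\<bar> \<le> 1 / e ^ p" by blast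
qed

lemma loc_negligible_add:
  assumes "loc_negligible u" "loc_negligible v"
  shows "loc_negligible (\<lambda>e x. u e x + v e x)"
  unfolding loc_negligible_def
proof (intro allI impI)
  fix K :: "(real^'a) set" and k assume K: "compact K"
  then have a: "\<forall>\<^sub>F e in at_right 0. \<forall>x\<in>K. \<bar>u e x\<bar> \<le> e ^ Suc k"
    "\<forall>\<^sub>F e in at_right 0. \<forall>x\<in>K. \<bar>v e x\<bar> \<le> e ^ Suc k"
    using assms unfolding loc_negligible_def by blast+
  show "\<forall>\<^sub>F e in at_right 0. \<forall>x\<in>K. \<bar>u e x + v e x\<bar> \<le> e ^ k"
    using a eventually_small[of "1 / 2", simplified]
  proof eventually_elim
    case (elim e)
    show ?case
    proof
      fix x assume "x \<in> K"
      with elim have "\<bar>u e x\<bar> \<le> e ^ Suc k" "\<bar>v e x\<bar> \<le> e ^ Suc k" by auto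
      then show "\<bar>u e x + v e x\<bar> \<le> e ^ k"
        using double_le_power[of e k] elim by linarith
    qed
  qed
qed

lemma loc_negligible_mult:
  assumes "loc_negligible u" "loc_moderate v"
  shows "loc_negligible (\<lambda>e x. u e x * v e x)"
  unfolding loc_negligible_def
proof (intro allI impI)
  fix K :: "(real^'a) set" and k assume K: "compact K"
  obtain p where p: "\<forall>\<^sub>F e in at_right 0. \<forall>x\<in>K. \<bar>v e x\<bar> \<le> 1 / e ^ p"
    using assms(2) K unfolding loc_moderate_def by blast
  have a: "\<forall>\<^sub>F e in at_right 0. \<forall>x\<in>K. \<bar>u e x\<bar> \<le> e ^ (k + p)"
    using assms K unfolding loc_negligible_def by blast
  show "\<forall>\<^sub>F e in at_right 0. \<forall>x\<in>K. \<bar>u e x * v e x\<bar> \<le> e ^ k"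
    using a p eventually_small[of 1, simplified]
  proof eventually_elim
    case (elim e)
    show ?case
    proof
      fix x assume "x \<in> K"
      with elim have "\<bar>u e x\<bar> * \<bar>v e x\<bar> \<le> e ^ (k + p) * (1 / e ^ p)" by (intro mult_mono) auto
      then show "\<bar>u e x * v e x\<bar> \<le> e ^ k" using elim by (simp add: abs_mult power_add)
    qed
  qed
qed

lemma loc_negligible_0: "loc_negligible (\<lambda>e x. 0)"
  unfolding loc_negligible_def
  using eventually_small[of 1, simplified] by (auto elim!: eventually_mono)

lemma loc_negligible_sum:
  "(\<And>i. i \<in> A \<Longrightarrow> loc_negligible (u i)) \<Longrightarrow> loc_negligible (\<lambda>e x. \<Sum>i\<in>A. u i e x)"
  by (induction A rule: infinite_finite_induct) (auto intro: loc_negligible_add loc_negligible_0)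

lemma partial_deriv_eq: "(f has_derivative f') (at x) \<Longrightarrow> partial_deriv i f x = f' (axis i 1)"
  unfolding partial_deriv_def by (drule frechet_derivative_at) simp

lemma differentiable_has_derivative_partial:
  assumes "f differentiable (at x)"
  shows "(f has_derivative (\<lambda>h. \<Sum>i\<in>UNIV. h $ i * partial_deriv i f x)) (at x)"
proof -
  obtain f' where f': "(f has_derivative f') (at x)"
    using assms by (auto simp: differentiable_def)
  interpret linear f' using f' by (rule has_derivative_linear)
  have "f' h = (\<Sum>i\<in>UNIV. h $ i * partial_deriv i f x)" for h
  proof -
    have "f' h = f' (\<Sum>i\<in>UNIV. (h $ i) *\<^sub>R axis i 1)"
      using basis_expansion[of h] by (simp add: scalar_mult_eq_scaleR)
    then show ?thesis by (simp add: sum scale partial_deriv_eq[OF f'])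
  qed
  then have "f' = (\<lambda>h. \<Sum>i\<in>UNIV. h $ i * partial_deriv i f x)" by (rule ext)
  from this[symmetric] show ?thesis using f' by simp
qed

lemma
  assumes "f differentiable (at x)" "g differentiable (at x)"
  shows partial_deriv_add: "partial_deriv i (\<lambda>x. f x + g x) x = partial_deriv i f x + partial_deriv i g x"
    and partial_deriv_mult: "partial_deriv i (\<lambda>x. f x * g x) x = partial_deriv i f x * g x + f x * partial_deriv i g x"
proof -
  obtain f' g' where fg: "(f has_derivative f') (at x)" "(g has_derivative g') (at x)"
    using assms by (auto simp: differentiable_def)
  show "partial_deriv i (\<lambda>x. f x + g x) x = partial_deriv i f x + partial_deriv i g x"
    using partial_deriv_eq[OF has_derivative_add[OF fg], of i] by (simp add: partial_deriv_eq[OF fg(1)] partial_deriv_eq[OF fg(2)])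
  show "partial_deriv i (\<lambda>x. f x * g x) x = partial_deriv i f x * g x + f x * partial_deriv i g x"
    using partial_deriv_eq[OF has_derivative_mult[OF fg], of i] by (simp add: partial_deriv_eq[OF fg(1)] partial_deriv_eq[OF fg(2)])
qed

lemma partial_deriv_const [simp]: "partial_deriv i (\<lambda>x. c) = (\<lambda>x. 0)"
  using partial_deriv_eq[OF has_derivative_const] by fastforce

lemma
  assumes "\<And>x. f differentiable (at x)"
  shows differentiable_compose_matrix: "(\<lambda>x. f (A *v x)) differentiable (at x)"
    and partial_deriv_compose_matrix:
      "partial_deriv i (\<lambda>x. f (A *v x)) x = (\<Sum>j\<in>UNIV. A $ j $ i * partial_deriv j f (A *v x))"
proof -
  have "((*v) A has_derivative (*v) A) (at x)"
    by (intro bounded_linear_imp_has_derivative linear_conv_bounded_linear[THEN iffD1] matrix_vector_mul_linear)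
  from has_derivative_compose[OF this differentiable_has_derivative_partial[OF assms]]
  have d: "((\<lambda>x. f (A *v x)) has_derivative
     (\<lambda>h. \<Sum>j\<in>UNIV. (A *v h) $ j * partial_deriv j f (A *v x))) (at x)" .
  then show "(\<lambda>x. f (A *v x)) differentiable (at x)" by (auto simp: differentiable_def)
  show "partial_deriv i (\<lambda>x. f (A *v x)) x = (\<Sum>j\<in>UNIV. A $ j $ i * partial_deriv j f (A *v x))"
    by (simp add: partial_deriv_eq[OF d] matrix_vector_mult_basis column_def)
qed

text \<open>Moderateness of all derivatives up to order \<open>m\<close>, in a form suited to induction on \<open>m\<close>.\<close>

primrec moderate_upto :: "nat \<Rightarrow> (real \<Rightarrow> real^'n::finite \<Rightarrow> real) \<Rightarrow> bool" where
  "moderate_upto 0 u \<longleftrightarrow> loc_moderate u \<and> (\<forall>e\<in>{0<..1}. \<forall>x. u e differentiable (at x))"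
| "moderate_upto (Suc m) u \<longleftrightarrow> (loc_moderate u \<and> (\<forall>e\<in>{0<..1}. \<forall>x. u e differentiable (at x))) \<and>
     (\<forall>i. moderate_upto m (\<lambda>e. partial_deriv i (u e)))"

lemma moderate_upto_D:
  "moderate_upto m u \<Longrightarrow> loc_moderate u"
  "moderate_upto m u \<Longrightarrow> e \<in> {0<..1} \<Longrightarrow> u e differentiable (at x)"
  by (cases m; simp)+

lemma moderate_upto_Suc_D: "moderate_upto (Suc m) u \<Longrightarrow> moderate_upto m u"
  by (induction m arbitrary: u) auto

lemma moderate_upto_iff:
  fixes u :: "real \<Rightarrow> real^'n::finite \<Rightarrow> real"
  shows "moderate_upto m u \<longleftrightarrow> (\<forall>is. length is \<le> m \<longrightarrow> moderate_upto 0 (\<lambda>e. multi_deriv is (u e)))"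
proof (induction m arbitrary: u)
  case (Suc m)
  have "moderate_upto (Suc m) u \<longleftrightarrow> moderate_upto 0 (\<lambda>e. multi_deriv [] (u e)) \<and>
      (\<forall>i. \<forall>is::'n list. length is \<le> m \<longrightarrow> moderate_upto 0 (\<lambda>e. multi_deriv (i # is) (u e)))"
    unfolding moderate_upto.simps(2) Suc[of "\<lambda>e. partial_deriv _ (u e)"] by simp
  also have "\<dots> \<longleftrightarrow> (\<forall>is. length is \<le> Suc m \<longrightarrow> moderate_upto 0 (\<lambda>e. multi_deriv is (u e)))"
    (is "?L \<longleftrightarrow> ?R")
  proof
    assume ?L
    show ?R
    proof (intro allI impI)
      fix "is" :: "'n list" assume "length is \<le> Suc m"
      with \<open>?L\<close> show "moderate_upto 0 (\<lambda>e. multi_deriv is (u e))"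
        by (cases "is") (simp_all del: moderate_upto.simps)
    qed
  next
    assume R: ?R
    have "moderate_upto 0 (\<lambda>e. multi_deriv (i # is) (u e))" if "length is \<le> m" for i "is"
      using R[rule_format, of "i # is"] that by simp
    then show ?L using R[rule_format, of "[]"] by simp
  qed
  finally show ?case .
qed simp

lemma moderate_nets_upto: "u \<in> moderate_nets \<longleftrightarrow> (\<forall>m. moderate_upto m u)"
proof -
  have "moderate_upto 0 (\<lambda>e. multi_deriv is (u e))" if "\<forall>m. moderate_upto m u" for "is"
    using that moderate_upto_iff[of "length is" u] by blast
  then have "(\<forall>m. moderate_upto m u) \<longleftrightarrow> (\<forall>is. moderate_upto 0 (\<lambda>e. multi_deriv is (u e)))"
    using moderate_upto_iff[of _ u] by blast
  then show ?thesis unfolding moderate_nets_iff smooth_def by auto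
qed

lemma moderate_upto_cong:
  assumes "\<forall>e\<in>{0<..1}. u e = v e" "moderate_upto m u"
  shows "moderate_upto m v"
  using assms
proof (induction m arbitrary: u v)
  case 0
  then show ?case using loc_moderate_cong[of u v] by simp
next
  case (Suc m)
  have "moderate_upto m (\<lambda>e. partial_deriv i (v e))" for i
    by (rule Suc.IH[of "\<lambda>e. partial_deriv i (u e)"]) (use Suc.prems in auto)
  then show ?case using loc_moderate_cong[of u v] Suc.prems by simp
qed

lemma moderate_upto_add:
  "moderate_upto m u \<Longrightarrow> moderate_upto m v \<Longrightarrow> moderate_upto m (\<lambda>e x. u e x + v e x)"
proof (induction m arbitrary: u v)
  case 0
  then show ?case by (auto intro: loc_moderate_add)
next
  case (Suc m)
  have "moderate_upto m (\<lambda>e. partial_deriv i (\<lambda>x. u e x + v e x))" for i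
    by (rule moderate_upto_cong[of "\<lambda>e x. partial_deriv i (u e) x + partial_deriv i (v e) x"])
      (use Suc in \<open>auto simp: partial_deriv_add\<close>)
  then show ?case using Suc.prems by (auto intro: loc_moderate_add)
qed

lemma moderate_upto_mult:
  "moderate_upto m u \<Longrightarrow> moderate_upto m v \<Longrightarrow> moderate_upto m (\<lambda>e x. u e x * v e x)"
proof (induction m arbitrary: u v)
  case 0
  then show ?case by (auto intro: loc_moderate_mult)
next
  case (Suc m)
  have "moderate_upto m u" "moderate_upto m v"
    using Suc.prems by (blast intro: moderate_upto_Suc_D)+
  moreover have "moderate_upto m (\<lambda>e. partial_deriv i (u e))" "moderate_upto m (\<lambda>e. partial_deriv i (v e))" for i
    using Suc.prems by auto
  ultimately have m: "moderate_upto m (\<lambda>e x. partial_deriv i (u e) x * v e x + u e x * partial_deriv i (v e) x)" for i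
    by (intro moderate_upto_add Suc.IH)
  have "moderate_upto m (\<lambda>e. partial_deriv i (\<lambda>x. u e x * v e x))" for i
    by (rule moderate_upto_cong[OF _ m[of i]]) (use Suc.prems in \<open>auto simp: partial_deriv_mult\<close>)
  then show ?case using Suc.prems by (auto intro: loc_moderate_mult)
qed

lemma moderate_upto_real: "r \<in> moderate_real \<Longrightarrow> moderate_upto m (\<lambda>e x. r e)"
proof (induction m arbitrary: r)
  case (Suc m)
  then show ?case using Suc.IH[of "\<lambda>_. 0"] by (auto intro: loc_moderate_real)
qed (auto intro: loc_moderate_real)

lemma moderate_upto_sum:
  "(\<And>i. i \<in> A \<Longrightarrow> moderate_upto m (u i)) \<Longrightarrow> moderate_upto m (\<lambda>e x. \<Sum>i\<in>A. u i e x)"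
  by (induction A rule: infinite_finite_induct) (auto intro: moderate_upto_add moderate_upto_real)

lemma moderate_nets_loc_moderate: "u \<in> moderate_nets \<Longrightarrow> loc_moderate u"
  using moderate_upto_D(1) moderate_nets_upto by blast

lemma moderate_nets_add: "u \<in> moderate_nets \<Longrightarrow> v \<in> moderate_nets \<Longrightarrow> (\<lambda>e x. u e x + v e x) \<in> moderate_nets"
  by (simp add: moderate_nets_upto moderate_upto_add)

lemma moderate_nets_mult: "u \<in> moderate_nets \<Longrightarrow> v \<in> moderate_nets \<Longrightarrow> (\<lambda>e x. u e x * v e x) \<in> moderate_nets"
  by (simp add: moderate_nets_upto moderate_upto_mult)

lemma moderate_nets_real: "r \<in> moderate_real \<Longrightarrow> (\<lambda>e x. r e) \<in> moderate_nets"
  by (simp add: moderate_nets_upto moderate_upto_real)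

lemma moderate_nets_minus: "u \<in> moderate_nets \<Longrightarrow> (\<lambda>e x. - u e x) \<in> moderate_nets"
  using moderate_nets_mult[OF moderate_nets_real[OF moderate_real_const[of "-1"]]] by simp

lemma moderate_nets_diff: "u \<in> moderate_nets \<Longrightarrow> v \<in> moderate_nets \<Longrightarrow> (\<lambda>e x. u e x - v e x) \<in> moderate_nets"
  using moderate_nets_add[OF _ moderate_nets_minus, of u v] by simp

lemma moderate_nets_sum:
  "(\<And>i. i \<in> A \<Longrightarrow> u i \<in> moderate_nets) \<Longrightarrow> (\<lambda>e x. \<Sum>i\<in>A. u i e x) \<in> moderate_nets"
  by (simp add: moderate_nets_upto moderate_upto_sum)

lemma moderate_nets_smooth: "smooth f \<Longrightarrow> (\<lambda>e. f) \<in> moderate_nets"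
  unfolding moderate_nets_iff by (auto intro!: loc_moderate_const smooth_continuous smooth_multi_deriv)

lemma moderate_nets_partial_deriv:
  "u \<in> moderate_nets \<Longrightarrow> (\<lambda>e. partial_deriv i (u e)) \<in> moderate_nets"
  unfolding moderate_nets_iff by (auto simp: smooth_partial_deriv simp flip: multi_deriv_Cons)

definition colombeau_rel ::
  "(real \<Rightarrow> real^'n::finite \<Rightarrow> real) \<Rightarrow> (real \<Rightarrow> real^'n \<Rightarrow> real) \<Rightarrow> bool" where
  "colombeau_rel u v \<longleftrightarrow>
     u \<in> moderate_nets \<and> v \<in> moderate_nets \<and> (\<lambda>\<epsilon> x. u \<epsilon> x - v \<epsilon> x) \<in> negligible_nets"

lemma loc_negligible_minus: "loc_negligible u \<Longrightarrow> loc_negligible (\<lambda>e x. - u e x)"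
  by (simp add: loc_negligible_def)

lemma colombeau_rel_iff:
  "colombeau_rel u v \<longleftrightarrow>
     u \<in> moderate_nets \<and> v \<in> moderate_nets \<and> loc_negligible (\<lambda>e x. u e x - v e x)"
  by (auto simp: colombeau_rel_def negligible_nets_iff moderate_nets_diff)

lemma part_equivp_colombeau_rel:
  "part_equivp (colombeau_rel :: (real \<Rightarrow> real^'n::finite \<Rightarrow> real) \<Rightarrow> _)"
proof (rule part_equivpI)
  show "\<exists>u :: real \<Rightarrow> real^'n \<Rightarrow> real. colombeau_rel u u"
    by (rule exI[of _ "\<lambda>_ _. 0"]) (simp add: colombeau_rel_iff moderate_nets_real loc_negligible_0)
  show "symp (colombeau_rel :: (real \<Rightarrow> real^'n \<Rightarrow> real) \<Rightarrow> _)"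
  proof (rule sympI)
    fix u v :: "real \<Rightarrow> real^'n \<Rightarrow> real" assume "colombeau_rel u v"
    then show "colombeau_rel v u"
      using loc_negligible_minus[of "\<lambda>e x. u e x - v e x"] by (simp add: colombeau_rel_iff)
  qed
  show "transp (colombeau_rel :: (real \<Rightarrow> real^'n \<Rightarrow> real) \<Rightarrow> _)"
  proof (rule transpI)
    fix u v w :: "real \<Rightarrow> real^'n \<Rightarrow> real" assume "colombeau_rel u v" "colombeau_rel v w"
    then show "colombeau_rel u w"
      using loc_negligible_add[of "\<lambda>e x. u e x - v e x" "\<lambda>e x. v e x - w e x"]
      by (simp add: colombeau_rel_iff)
  qed
qed

quotient_type (overloaded) 'n colombeau = "real \<Rightarrow> real^'n::finite \<Rightarrow> real" / partial: colombeau_rel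
  by (rule part_equivp_colombeau_rel)

instantiation colombeau :: (finite) zero
begin

lift_definition zero_colombeau :: "'a colombeau" is "\<lambda>_ _. 0"
  by (simp add: colombeau_rel_iff moderate_nets_real loc_negligible_0)

instance ..

end

lemma abs_colombeau_eq_iff:
  assumes "u \<in> moderate_nets" "v \<in> moderate_nets"
  shows "abs_colombeau u = abs_colombeau v \<longleftrightarrow> (\<lambda>\<epsilon> x. u \<epsilon> x - v \<epsilon> x) \<in> negligible_nets"
  using Quotient3_rel[OF Quotient3_colombeau, of u v] assms
  by (auto simp: colombeau_rel_def negligible_nets_iff moderate_nets_real loc_negligible_0)

lemma rep_abs_colombeau:
  assumes "u \<in> moderate_nets"
  shows "colombeau_rel (rep_colombeau (abs_colombeau u)) u"
  using rep_abs_rsp_left[OF Quotient3_colombeau, of u u] assms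
  by (simp add: colombeau_rel_iff loc_negligible_0)

section \<open>Derivatives along vector fields\<close>

text \<open>A vector field \<open>\<xi>\<close> with components \<open>\<xi>\<^sub>k\<close> acts as the operator \<open>\<Sum>k. \<xi>\<^sub>k \<partial>\<^sub>k\<close>.\<close>

definition vf_deriv :: "(real^'n::finite \<Rightarrow> real^'n) \<Rightarrow> (real^'n \<Rightarrow> real) \<Rightarrow> real^'n \<Rightarrow> real" where
  "vf_deriv \<xi> f x = (\<Sum>k\<in>UNIV. \<xi> x $ k * partial_deriv k f x)"

text \<open>
  The choice of representative is immaterial for smooth \<open>\<xi>\<close>; see \<open>colombeau_vf_deriv_abs\<close> below.
\<close>

definition colombeau_vf_deriv :: "(real^'n::finite \<Rightarrow> real^'n) \<Rightarrow> 'n colombeau \<Rightarrow> 'n colombeau" where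
  "colombeau_vf_deriv \<xi> u = abs_colombeau (\<lambda>\<epsilon>. vf_deriv \<xi> (rep_colombeau u \<epsilon>))"

lemma partial_deriv_estimate:
  fixes f :: "real^'n::finite \<Rightarrow> real"
  assumes f: "smooth f" and h: "0 < h" "h \<le> 1"
    and A: "\<And>y. norm (y - x) \<le> 1 \<Longrightarrow> \<bar>f y\<bar> \<le> A"
    and B: "\<And>y. norm (y - x) \<le> 1 \<Longrightarrow> \<bar>partial_deriv i (partial_deriv i f) y\<bar> \<le> B"
  shows "\<bar>partial_deriv i f x\<bar> \<le> 2 * A / h + B * h"
proof -
  define g where "g t = x + t *\<^sub>R axis i 1" for t :: real
  have ng: "norm (g t - x) = \<bar>t\<bar>" for t by (simp add: g_def)
  have D: "((\<lambda>t. F (g t)) has_real_derivative partial_deriv i F (g t)) (at t)" if "smooth F" for F t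
  proof -
    have "(g has_derivative (\<lambda>s. s *\<^sub>R axis i 1)) (at t)"
      unfolding g_def by (auto intro!: derivative_eq_intros)
    from has_derivative_compose[OF this differentiable_has_derivative_partial[OF smooth_differentiable[OF that]]]
    have "((\<lambda>t. F (g t)) has_derivative
        (\<lambda>s. \<Sum>j\<in>UNIV. (s *\<^sub>R axis i 1) $ j * partial_deriv j F (g t))) (at t)" .
    also have "(\<lambda>s. \<Sum>j\<in>UNIV. (s *\<^sub>R axis i 1 :: real^'n) $ j * partial_deriv j F (g t)) =
        (*) (partial_deriv i F (g t))"
      by (rule ext) (simp add: axis_def if_distrib[of "\<lambda>a. a * _"] if_distrib[of "\<lambda>a. _ * a"] sum.delta cong: if_cong)
    finally show ?thesis by (simp add: has_field_derivative_def)
  qed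
  obtain s where s: "0 < s" "s < h" "f (g h) - f (g 0) = (h - 0) * partial_deriv i f (g s)"
    using MVT2[OF h(1), of "\<lambda>t. f (g t)" "\<lambda>t. partial_deriv i f (g t)"] D[OF f] by blast
  obtain r where r: "0 < r" "r < s"
    "partial_deriv i f (g s) - partial_deriv i f (g 0) = (s - 0) * partial_deriv i (partial_deriv i f) (g r)"
    using MVT2[OF s(1), of "\<lambda>t. partial_deriv i f (g t)" "\<lambda>t. partial_deriv i (partial_deriv i f) (g t)"]
      D[OF smooth_partial_deriv[OF f]] by blast
  have "\<bar>f (g h)\<bar> \<le> A" "\<bar>f (g 0)\<bar> \<le> A"
    using h by (auto intro!: A simp: ng)
  then have "\<bar>f (g h) - f (g 0)\<bar> \<le> 2 * A" by linarith
  then have 1: "\<bar>partial_deriv i f (g s)\<bar> \<le> 2 * A / h"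
    using h s(3) by (simp add: field_simps abs_mult)
  have "\<bar>partial_deriv i (partial_deriv i f) (g r)\<bar> \<le> B"
    using h r s by (auto intro!: B simp: ng)
  then have "\<bar>(s - 0) * partial_deriv i (partial_deriv i f) (g r)\<bar> \<le> h * B"
    unfolding abs_mult using s by (intro mult_mono) auto
  then have 2: "\<bar>partial_deriv i f (g s) - partial_deriv i f (g 0)\<bar> \<le> B * h"
    using r(3) by (simp add: mult.commute)
  have "g 0 = x" by (simp add: g_def)
  with 2 have "\<bar>partial_deriv i f (g s) - partial_deriv i f x\<bar> \<le> B * h" by simp
  then show ?thesis using 1 by linarith
qed

lemma loc_negligible_partial_deriv:
  assumes "u \<in> moderate_nets" "loc_negligible u"
  shows "loc_negligible (\<lambda>e. partial_deriv i (u e))"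
  unfolding loc_negligible_def
proof (intro allI impI)
  fix K :: "(real^'a) set" and k assume K: "compact K"
  obtain R where R: "\<And>x. x \<in> K \<Longrightarrow> norm x \<le> R"
    using compact_imp_bounded[OF K] unfolding bounded_iff by blast
  define L where "L = cball (0::real^'a) (R + 1)"
  have L: "compact L" by (simp add: L_def)
  have KL: "y \<in> L" if "x \<in> K" "norm (y - x) \<le> 1" for x y
    using R[OF that(1)] that(2) norm_triangle_ineq[of x "y - x"] by (simp add: L_def)
  have "loc_moderate (\<lambda>e. partial_deriv i (partial_deriv i (u e)))"
    by (intro moderate_nets_loc_moderate moderate_nets_partial_deriv assms(1))
  then obtain p where p: "\<forall>\<^sub>F e in at_right 0. \<forall>x\<in>L. \<bar>partial_deriv i (partial_deriv i (u e)) x\<bar> \<le> 1 / e ^ p"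
    using L unfolding loc_moderate_def by blast
  define q where "q = p + k + 1"
  have a: "\<forall>\<^sub>F e in at_right 0. \<forall>x\<in>L. \<bar>u e x\<bar> \<le> e ^ (q + k + 1)"
    using assms(2) L unfolding loc_negligible_def by blast
  show "\<forall>\<^sub>F e in at_right 0. \<forall>x\<in>K. \<bar>partial_deriv i (u e) x\<bar> \<le> e ^ k"
    using a p eventually_small[of "1 / 3", simplified]
  proof eventually_elim
    case (elim e)
    show ?case
    proof
      fix x assume x: "x \<in> K"
      have "\<bar>partial_deriv i (u e) x\<bar> \<le> 2 * e ^ (q + k + 1) / e ^ q + (1 / e ^ p) * e ^ q"
      proof (rule partial_deriv_estimate)
        show "smooth (u e)" using assms(1) elim by (auto simp: moderate_nets_iff)
        show "0 < e ^ q" "e ^ q \<le> 1" using elim by (auto intro: power_le_one)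
      qed (use elim KL[OF x] in auto)
      also have "2 * e ^ (q + k + 1) / e ^ q + (1 / e ^ p) * e ^ q = (3 * e) * e ^ k"
        using elim by (simp add: q_def power_add field_simps)
      also have "\<dots> \<le> 1 * e ^ k"
        using elim by (intro mult_right_mono) auto
      finally show "\<bar>partial_deriv i (u e) x\<bar> \<le> e ^ k" by simp
    qed
  qed
qed

lemma moderate_nets_vf_deriv:
  assumes "\<And>k. smooth (\<lambda>x. \<xi> x $ k)" "u \<in> moderate_nets"
  shows "(\<lambda>e. vf_deriv \<xi> (u e)) \<in> moderate_nets"
  unfolding vf_deriv_def
  using moderate_nets_mult[OF moderate_nets_smooth[OF assms(1)] moderate_nets_partial_deriv[OF assms(2)]]
  by (intro moderate_nets_sum) simp

lemma colombeau_rel_vf_deriv: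
  assumes \<xi>: "\<And>k. smooth (\<lambda>x. \<xi> x $ k)" and uv: "colombeau_rel u v"
  shows "colombeau_rel (\<lambda>e. vf_deriv \<xi> (u e)) (\<lambda>e. vf_deriv \<xi> (v e))"
proof -
  have m: "u \<in> moderate_nets" "v \<in> moderate_nets" and n: "loc_negligible (\<lambda>e x. u e x - v e x)"
    using uv by (auto simp: colombeau_rel_iff)
  have "loc_negligible (\<lambda>e. partial_deriv k (\<lambda>x. u e x - v e x))" for k
    by (intro loc_negligible_partial_deriv[of "\<lambda>e x. u e x - v e x"] moderate_nets_diff m n)
  moreover have "loc_moderate (\<lambda>e x. \<xi> x $ k)" for k
    by (intro loc_moderate_const smooth_continuous \<xi>)
  ultimately have s: "loc_negligible (\<lambda>e x. \<Sum>k\<in>UNIV. partial_deriv k (\<lambda>x. u e x - v e x) x * \<xi> x $ k)"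
    by (intro loc_negligible_sum loc_negligible_mult)
  have pd: "partial_deriv k (\<lambda>x. u e x - v e x) x = partial_deriv k (u e) x - partial_deriv k (v e) x"
    if "e \<in> {0<..1}" for e x k
  proof -
    have d: "u e differentiable (at x)" "v e differentiable (at x)"
      using m that by (auto simp: moderate_nets_iff intro: smooth_differentiable)
    then have "partial_deriv k (\<lambda>x. (u e x - v e x) + v e x) x =
        partial_deriv k (\<lambda>x. u e x - v e x) x + partial_deriv k (v e) x"
      by (intro partial_deriv_add differentiable_diff)
    then show ?thesis by simp
  qed
  have "loc_negligible (\<lambda>e x. vf_deriv \<xi> (u e) x - vf_deriv \<xi> (v e) x)"
    by (rule loc_negligible_cong[OF _ s])
      (auto simp: pd vf_deriv_def sum_subtractf algebra_simps)
  then show ?thesis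
    using m by (simp add: colombeau_rel_iff moderate_nets_vf_deriv \<xi>)
qed

lemma colombeau_vf_deriv_abs:
  assumes "\<And>k. smooth (\<lambda>x. \<xi> x $ k)" "u \<in> moderate_nets"
  shows "colombeau_vf_deriv \<xi> (abs_colombeau u) = abs_colombeau (\<lambda>e. vf_deriv \<xi> (u e))"
  unfolding colombeau_vf_deriv_def
  by (intro Quotient3_rel_abs[OF Quotient3_colombeau] colombeau_rel_vf_deriv assms rep_abs_colombeau)

section \<open>Rotations\<close>

text \<open>
  Over an arbitrary commutative ring, to cover both \<open>SO(n, \<real>)\<close> and the group over \<open>gen_real\<close>.
\<close>

definition SO :: "('a::comm_ring_1^'n::finite^'n) set" where
  "SO = {A. transpose A ** A = mat 1 \<and> det A = 1}"

text \<open>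
  The choice of representatives is immaterial for \<open>A \<in> SO\<close>; see \<open>colombeau_compose_abs\<close> below.
  Real matrices are embedded as constant nets by \<open>of_real\<close>; see \<open>colombeau_compose_of_real\<close>.
\<close>

definition colombeau_compose :: "'n::finite colombeau \<Rightarrow> gen_real^'n^'n \<Rightarrow> 'n colombeau" where
  "colombeau_compose u A =
     abs_colombeau (\<lambda>\<epsilon> x. rep_colombeau u \<epsilon> (map_matrix (\<lambda>r. rep_gen_real r \<epsilon>) A *v x))"

definition rotation_invariant :: "(real^'n::finite \<Rightarrow> real) \<Rightarrow> bool" where
  "rotation_invariant f \<longleftrightarrow> (\<forall>A\<in>SO. (\<lambda>x. f (A *v x)) = f)"

text \<open>The vector field \<open>x\<^sub>i \<partial>\<^sub>j - x\<^sub>j \<partial>\<^sub>i\<close>.\<close>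

definition rotation_field :: "'n::finite \<Rightarrow> 'n \<Rightarrow> real^'n \<Rightarrow> real^'n" where
  "rotation_field i j x = (x $ i) *\<^sub>R axis j 1 - (x $ j) *\<^sub>R axis i 1"

text \<open>
  All linear combinations. The index type carries no order, so the sum is not restricted to
  \<open>i < j\<close>; this adds nothing, as the field is antisymmetric in \<open>(i, j)\<close>.
\<close>

definition rotation_generators :: "(real^'n::finite \<Rightarrow> real^'n) set" where
  "rotation_generators =
     {(\<lambda>x. \<Sum>i\<in>UNIV. \<Sum>j\<in>UNIV. c i j *\<^sub>R rotation_field i j x) | c. True}"

lemma smooth_0: "smooth (\<lambda>x::real^'n::finite. 0)"
proof -
  have "multi_deriv is (\<lambda>x::real^'n. 0) = (\<lambda>x. 0)" for "is" :: "'n list"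
    by (induction "is") auto
  then show ?thesis by (simp add: smooth_def)
qed

lemma smooth_iff: "smooth f \<longleftrightarrow> (\<forall>x. f differentiable (at x)) \<and> (\<forall>i. smooth (partial_deriv i f))"
proof
  assume "(\<forall>x. f differentiable (at x)) \<and> (\<forall>i. smooth (partial_deriv i f))"
  then show "smooth f"
    unfolding smooth_def by (metis list.exhaust multi_deriv_Cons multi_deriv_Nil)
qed (auto intro: smooth_partial_deriv smooth_differentiable)

lemma smooth_linear:
  assumes "linear f"
  shows "smooth f"
proof -
  have d: "(f has_derivative f) (at x)" for x
    using assms by (intro bounded_linear_imp_has_derivative) (simp add: linear_conv_bounded_linear)
  have c: "smooth (\<lambda>x::real^'a. c)" for c :: real
    unfolding smooth_iff[of "\<lambda>x. c"] by (simp add: smooth_0)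
  have "partial_deriv i f = (\<lambda>x. f (axis i 1))" for i
    by (rule ext) (rule partial_deriv_eq[OF d])
  then show ?thesis
    using d c by (subst smooth_iff) (auto simp: differentiable_def)
qed

lemma smooth_rotation_generators:
  assumes "\<xi> \<in> rotation_generators"
  shows "smooth (\<lambda>x. \<xi> x $ k)"
proof (rule smooth_linear)
  show "linear (\<lambda>x. \<xi> x $ k)"
    using assms
    by (auto simp: rotation_generators_def rotation_field_def algebra_simps sum.distrib sum_distrib_left
        sum_subtractf intro!: linearI)
qed

lemma abs_gen_real_eq_iff:
  assumes "r \<in> moderate_real" "s \<in> moderate_real"
  shows "abs_gen_real r = abs_gen_real s \<longleftrightarrow> (\<lambda>\<epsilon>. r \<epsilon> - s \<epsilon>) \<in> negligible_real"
  using Quotient3_rel[OF Quotient3_gen_real, of r s] assms by (auto simp: gen_real_rel_def)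

lemma rep_gen_real_moderate: "rep_gen_real r \<in> moderate_real"
  using Quotient3_rep_reflp[OF Quotient3_gen_real, of r] by (simp add: gen_real_rel_def)

lemma abs_rep_gen_real: "abs_gen_real (rep_gen_real r) = r"
  by (rule Quotient3_abs_rep[OF Quotient3_gen_real])

lemma abs_gen_real_sum:
  "(\<And>i. i \<in> A \<Longrightarrow> r i \<in> moderate_real) \<Longrightarrow>
     abs_gen_real (\<lambda>\<epsilon>. \<Sum>i\<in>A. r i \<epsilon>) = (\<Sum>i\<in>A. abs_gen_real (r i))"
proof (induction A rule: infinite_finite_induct)
  case (insert i A)
  have "abs_gen_real (r i) + abs_gen_real (\<lambda>\<epsilon>. \<Sum>i\<in>A. r i \<epsilon>) = abs_gen_real (\<lambda>\<epsilon>. r i \<epsilon> + (\<Sum>i\<in>A. r i \<epsilon>))"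
    using insert.prems by (intro plus_gen_real.abs_eq gen_real_rel_refl moderate_real_sum) auto
  then show ?case using insert by simp
qed (simp_all add: zero_gen_real.abs_eq)

lemma of_real_gen_real: "of_real c = abs_gen_real (\<lambda>_. c)"
  unfolding of_real_def one_gen_real.abs_eq
  by (subst scaleR_gen_real.abs_eq) (auto intro: gen_real_rel_refl)

lemma SO_entries_bounded:
  fixes A :: "gen_real^'n::finite^'n"
  assumes A: "A \<in> SO" and m: "\<And>i j. (\<lambda>\<epsilon>. a \<epsilon> $ i $ j) \<in> moderate_real"
    and Aa: "\<And>i j. A $ i $ j = abs_gen_real (\<lambda>\<epsilon>. a \<epsilon> $ i $ j)"
  shows "\<forall>\<^sub>F \<epsilon> in at_right 0. \<forall>i j. \<bar>a \<epsilon> $ i $ j\<bar> \<le> 2"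
proof -
  have "\<forall>\<^sub>F \<epsilon> in at_right 0. \<bar>a \<epsilon> $ i $ j\<bar> \<le> 2" for i j
  proof -
    have "abs_gen_real (\<lambda>\<epsilon>. \<Sum>k\<in>UNIV. a \<epsilon> $ k $ j * a \<epsilon> $ k $ j) = (\<Sum>k\<in>UNIV. A $ k $ j * A $ k $ j)"
      by (subst abs_gen_real_sum)
        (auto simp: Aa times_gen_real.abs_eq gen_real_rel_refl m intro: moderate_real_mult)
    also have "\<dots> = (transpose A ** A) $ j $ j"
      by (simp add: matrix_matrix_mult_def transpose_def)
    also have "\<dots> = abs_gen_real (\<lambda>_. 1)"
      using A by (simp add: SO_def mat_def one_gen_real.abs_eq)
    finally have eq: "abs_gen_real (\<lambda>\<epsilon>. \<Sum>k\<in>UNIV. a \<epsilon> $ k $ j * a \<epsilon> $ k $ j) = abs_gen_real (\<lambda>_. 1)" .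
    have "(\<lambda>\<epsilon>. \<Sum>k\<in>UNIV. a \<epsilon> $ k $ j * a \<epsilon> $ k $ j) \<in> moderate_real"
      by (intro moderate_real_sum moderate_real_mult m)
    from eq[unfolded abs_gen_real_eq_iff[OF this moderate_real_const]]
    have "(\<lambda>\<epsilon>. (\<Sum>k\<in>UNIV. a \<epsilon> $ k $ j * a \<epsilon> $ k $ j) - 1) \<in> negligible_real" .
    then have "\<forall>\<^sub>F \<epsilon> in at_right 0. \<bar>(\<Sum>k\<in>UNIV. a \<epsilon> $ k $ j * a \<epsilon> $ k $ j) - 1\<bar> \<le> \<epsilon> ^ 0"
      unfolding negligible_real_iff by blast
    then show ?thesis
    proof eventually_elim
      case (elim e)
      have "a e $ i $ j * a e $ i $ j \<le> (\<Sum>k\<in>UNIV. a e $ k $ j * a e $ k $ j)"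
        by (rule member_le_sum) auto
      then have "\<bar>a e $ i $ j\<bar>\<^sup>2 \<le> 2\<^sup>2"
        using elim by (simp add: power2_eq_square)
      then show ?case by (rule power2_le_imp_le) simp
    qed
  qed
  then show ?thesis by (simp add: eventually_all_finite)
qed

text \<open>The bound \<open>2\<close> is the one provided by \<open>SO_entries_bounded\<close>.\<close>

definition loc_bounded :: "(real \<Rightarrow> real^'n::finite^'n) \<Rightarrow> bool" where
  "loc_bounded a \<longleftrightarrow> (\<forall>\<^sub>F e in at_right 0. \<forall>i j. \<bar>a e $ i $ j\<bar> \<le> 2)"

lemma norm_matrix_vector_le:
  fixes a :: "real^'n::finite^'n"
  assumes "\<forall>i j. \<bar>a $ i $ j\<bar> \<le> c"
  shows "norm (a *v x) \<le> real CARD('n) * real CARD('n) * c * norm x"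
proof -
  have c: "0 \<le> c" using assms abs_ge_zero order_trans by metis
  have "norm (a *v x) \<le> (\<Sum>i\<in>UNIV. \<bar>(a *v x) $ i\<bar>)" by (rule norm_le_l1_cart)
  also have "\<dots> \<le> (\<Sum>i\<in>(UNIV::'n set). \<Sum>j\<in>(UNIV::'n set). c * norm x)"
  proof (rule sum_mono)
    fix i
    have "\<bar>(a *v x) $ i\<bar> \<le> (\<Sum>j\<in>UNIV. \<bar>a $ i $ j * x $ j\<bar>)"
      unfolding matrix_vector_mult_def by (simp add: sum_abs)
    also have "\<dots> \<le> (\<Sum>j\<in>(UNIV::'n set). c * norm x)"
      unfolding abs_mult using assms c by (intro sum_mono mult_mono) (auto simp: component_le_norm_cart)
    finally show "\<bar>(a *v x) $ i\<bar> \<le> (\<Sum>j\<in>(UNIV::'n set). c * norm x)" .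
  qed
  finally show ?thesis by (simp add: mult.assoc)
qed

lemma loc_bounded_image:
  assumes "loc_bounded a" "compact K"
  obtains R where "0 \<le> R" "\<forall>\<^sub>F e in at_right 0. \<forall>x\<in>K. a e *v x \<in> cball (0::real^'n::finite) R"
proof -
  obtain r where r: "0 < r" "\<And>x. x \<in> K \<Longrightarrow> norm x \<le> r"
    using compact_imp_bounded[OF assms(2)] unfolding bounded_pos by blast
  let ?c = "real CARD('n) * real CARD('n) * 2"
  have "\<forall>\<^sub>F e in at_right 0. \<forall>x\<in>K. a e *v x \<in> cball 0 (?c * r)"
    using assms(1) unfolding loc_bounded_def
  proof eventually_elim
    case (elim e)
    show ?case
    proof
      fix x assume "x \<in> K"
      have "norm (a e *v x) \<le> ?c * norm x" by (rule norm_matrix_vector_le[OF elim])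
      also have "\<dots> \<le> ?c * r" using r(2)[OF \<open>x \<in> K\<close>] by (intro mult_left_mono) auto
      finally show "a e *v x \<in> cball 0 (?c * r)" by simp
    qed
  qed
  then show ?thesis using that[of "?c * r"] r by auto
qed

lemma loc_moderate_compose:
  fixes u :: "real \<Rightarrow> real^'n::finite \<Rightarrow> real"
  assumes "loc_bounded a" "loc_moderate u"
  shows "loc_moderate (\<lambda>e x. u e (a e *v x))"
  unfolding loc_moderate_def
proof (intro allI impI)
  fix K :: "(real^'n) set" assume K: "compact K"
  obtain R where "0 \<le> R" and R: "\<forall>\<^sub>F e in at_right 0. \<forall>x\<in>K. a e *v x \<in> cball (0::real^'n) R"
    by (rule loc_bounded_image[OF assms(1) K])
  obtain p where p: "\<forall>\<^sub>F e in at_right 0. \<forall>x\<in>cball 0 R. \<bar>u e x\<bar> \<le> 1 / e ^ p"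
    using assms(2) compact_cball[of 0 R] unfolding loc_moderate_def by blast
  have "\<forall>\<^sub>F e in at_right 0. \<forall>x\<in>K. \<bar>u e (a e *v x)\<bar> \<le> 1 / e ^ p"
    using R p by eventually_elim blast
  then show "\<exists>p. \<forall>\<^sub>F e in at_right 0. \<forall>x\<in>K. \<bar>u e (a e *v x)\<bar> \<le> 1 / e ^ p" by blast
qed

lemma loc_negligible_compose:
  fixes u :: "real \<Rightarrow> real^'n::finite \<Rightarrow> real"
  assumes "loc_bounded a" "loc_negligible u"
  shows "loc_negligible (\<lambda>e x. u e (a e *v x))"
  unfolding loc_negligible_def
proof (intro allI impI)
  fix K :: "(real^'n) set" and k assume K: "compact K"
  obtain R where "0 \<le> R" and R: "\<forall>\<^sub>F e in at_right 0. \<forall>x\<in>K. a e *v x \<in> cball (0::real^'n) R"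
    by (rule loc_bounded_image[OF assms(1) K])
  have p: "\<forall>\<^sub>F e in at_right 0. \<forall>x\<in>cball 0 R. \<bar>u e x\<bar> \<le> e ^ k"
    using assms(2) compact_cball[of 0 R] unfolding loc_negligible_def by blast
  show "\<forall>\<^sub>F e in at_right 0. \<forall>x\<in>K. \<bar>u e (a e *v x)\<bar> \<le> e ^ k"
    using R p by eventually_elim blast
qed

lemma moderate_upto_compose:
  assumes "loc_bounded a" "\<And>i j. (\<lambda>e. a e $ i $ j) \<in> moderate_real"
  shows "moderate_upto m u \<Longrightarrow> moderate_upto m (\<lambda>e x. u e (a e *v x))"
proof (induction m arbitrary: u)
  case 0
  then show ?case using assms by (auto intro: loc_moderate_compose differentiable_compose_matrix)
next
  case (Suc m)
  have m: "moderate_upto m (\<lambda>e x. \<Sum>j\<in>UNIV. a e $ j $ i * partial_deriv j (u e) (a e *v x))" for i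
    using Suc by (intro moderate_upto_sum moderate_upto_mult moderate_upto_real assms Suc.IH) auto
  have "moderate_upto m (\<lambda>e. partial_deriv i (\<lambda>x. u e (a e *v x)))" for i
    by (rule moderate_upto_cong[OF _ m[of i]])
      (use Suc.prems in \<open>auto simp: fun_eq_iff partial_deriv_compose_matrix\<close>)
  then show ?case
    using Suc.prems assms by (auto intro: loc_moderate_compose differentiable_compose_matrix)
qed

lemma moderate_nets_compose:
  assumes "loc_bounded a" "\<And>i j. (\<lambda>e. a e $ i $ j) \<in> moderate_real" "u \<in> moderate_nets"
  shows "(\<lambda>e x. u e (a e *v x)) \<in> moderate_nets"
  using assms by (simp add: moderate_nets_upto moderate_upto_compose)

lemma differentiable_lipschitz_cball:
  fixes f :: "real^'n::finite \<Rightarrow> real"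
  assumes f: "\<And>x. f differentiable (at x)"
    and B: "\<And>z i. z \<in> cball 0 R \<Longrightarrow> \<bar>partial_deriv i f z\<bar> \<le> B"
    and xy: "x \<in> cball 0 R" "y \<in> cball 0 R"
  shows "\<bar>f x - f y\<bar> \<le> real CARD('n) * B * norm (x - y)"
proof -
  define D where "D z h = (\<Sum>i\<in>UNIV. h $ i * partial_deriv i f z)" for z h
  have D: "(f has_derivative D z) (at z within cball 0 R)" for z
    unfolding D_def by (rule has_derivative_at_withinI[OF differentiable_has_derivative_partial[OF f]])
  have "onorm (D z) \<le> real CARD('n) * B" if z: "z \<in> cball 0 R" for z
  proof (rule onorm_le)
    fix h :: "real^'n"
    have "norm (D z h) \<le> (\<Sum>i\<in>UNIV. \<bar>h $ i * partial_deriv i f z\<bar>)"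
      unfolding D_def real_norm_def by (rule sum_abs)
    also have "\<dots> \<le> (\<Sum>i\<in>(UNIV::'n set). norm h * B)"
    proof (rule sum_mono)
      fix i
      show "\<bar>h $ i * partial_deriv i f z\<bar> \<le> norm h * B"
        unfolding abs_mult using B[OF z] by (intro mult_mono) (auto simp: component_le_norm_cart)
    qed
    finally show "norm (D z h) \<le> real CARD('n) * B * norm h" by (simp add: mult_ac)
  qed
  from differentiable_bound[OF convex_cball D this xy]
  have "norm (f x - f y) \<le> (real CARD('n) * B) * norm (x - y)" .
  then show ?thesis by simp
qed

lemma loc_negligible_compose_diff:
  fixes u :: "real \<Rightarrow> real^'n::finite \<Rightarrow> real"
  assumes a: "loc_bounded a" and b: "loc_bounded b"
    and ab: "\<And>i j. (\<lambda>e. a e $ i $ j - b e $ i $ j) \<in> negligible_real"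
    and u: "u \<in> moderate_nets"
  shows "loc_negligible (\<lambda>e x. u e (a e *v x) - u e (b e *v x))"
  unfolding loc_negligible_def
proof (intro allI impI)
  fix K :: "(real^'n) set" and k assume K: "compact K"
  obtain R1 where "0 \<le> R1" and R1: "\<forall>\<^sub>F e in at_right 0. \<forall>x\<in>K. a e *v x \<in> cball (0::real^'n) R1"
    by (rule loc_bounded_image[OF a K])
  obtain R2 where "0 \<le> R2" and R2: "\<forall>\<^sub>F e in at_right 0. \<forall>x\<in>K. b e *v x \<in> cball (0::real^'n) R2"
    by (rule loc_bounded_image[OF b K])
  define R where "R = max R1 R2"
  obtain r where r: "0 < r" "\<And>x. x \<in> K \<Longrightarrow> norm x \<le> r"
    using compact_imp_bounded[OF K] unfolding bounded_pos by blast
  have "\<exists>p. \<forall>\<^sub>F e in at_right 0. \<forall>x\<in>cball 0 R. \<bar>partial_deriv i (u e) x\<bar> \<le> 1 / e ^ p" for i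
  proof -
    have "loc_moderate (\<lambda>e. partial_deriv i (u e))"
      by (intro moderate_nets_loc_moderate moderate_nets_partial_deriv u)
    then show ?thesis using compact_cball[of 0 R] unfolding loc_moderate_def by blast
  qed
  then have "\<exists>P. \<forall>i. \<forall>\<^sub>F e in at_right 0. \<forall>x\<in>cball 0 R. \<bar>partial_deriv i (u e) x\<bar> \<le> 1 / e ^ P i"
    by (intro choice allI)
  then obtain P where P: "\<forall>i. \<forall>\<^sub>F e in at_right 0. \<forall>x\<in>cball 0 R. \<bar>partial_deriv i (u e) x\<bar> \<le> 1 / e ^ P i"
    by (rule exE)
  define p where "p = Max (range P)"
  have Pp: "P i \<le> p" for i by (simp add: p_def)
  have p: "\<forall>\<^sub>F e in at_right 0. \<forall>i. \<forall>x\<in>cball 0 R. \<bar>partial_deriv i (u e) x\<bar> \<le> 1 / e ^ P i"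
    by (rule eventually_all_finite) (rule P[rule_format])
  let ?n = "real CARD('n)"
  have n: "\<forall>\<^sub>F e in at_right 0. \<forall>i j. \<bar>a e $ i $ j - b e $ i $ j\<bar> \<le> e ^ (p + k + 1)"
    by (intro eventually_all_finite ab[unfolded negligible_real_iff, rule_format])
  define c where "c = ?n * (?n * ?n * r)"
  have c: "0 < 1 / c" using r by (simp add: c_def)
  show "\<forall>\<^sub>F e in at_right 0. \<forall>x\<in>K. \<bar>u e (a e *v x) - u e (b e *v x)\<bar> \<le> e ^ k"
    using R1 R2 p n eventually_small[OF c]
  proof eventually_elim
    case (elim e)
    show ?case
    proof
      fix x assume x: "x \<in> K"
      have "\<bar>u e (a e *v x) - u e (b e *v x)\<bar> \<le> ?n * (1 / e ^ p) * norm (a e *v x - b e *v x)"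
      proof (rule differentiable_lipschitz_cball)
        show "u e differentiable (at z)" for z
          using u elim by (auto simp: moderate_nets_iff intro: smooth_differentiable)
        show "a e *v x \<in> cball 0 R" "b e *v x \<in> cball 0 R"
          using elim x by (auto simp: R_def)
        show "\<bar>partial_deriv i (u e) z\<bar> \<le> 1 / e ^ p" if "z \<in> cball 0 R" for z i
        proof -
          have "\<bar>partial_deriv i (u e) z\<bar> \<le> 1 / e ^ P i" using elim that by blast
          also have "\<dots> \<le> 1 / e ^ p" using elim Pp by (intro inverse_power_mono) auto
          finally show ?thesis .
        qed
      qed
      also have "\<dots> \<le> ?n * (1 / e ^ p) * (?n * ?n * e ^ (p + k + 1) * r)"
      proof (rule mult_left_mono)
        have "norm (a e *v x - b e *v x) = norm ((a e - b e) *v x)"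
          by (simp add: matrix_vector_mult_diff_rdistrib)
        also have "\<dots> \<le> ?n * ?n * e ^ (p + k + 1) * norm x"
          using elim by (intro norm_matrix_vector_le) auto
        also have "\<dots> \<le> ?n * ?n * e ^ (p + k + 1) * r"
          using r(2)[OF x] elim by (intro mult_left_mono) auto
        finally show "norm (a e *v x - b e *v x) \<le> ?n * ?n * e ^ (p + k + 1) * r" .
      qed (use elim in auto)
      also have "\<dots> = (c * e) * e ^ k"
        using elim by (simp add: c_def power_add field_simps)
      also have "\<dots> \<le> 1 * e ^ k"
        using elim c by (intro mult_right_mono) (auto simp: field_simps)
      finally show "\<bar>u e (a e *v x) - u e (b e *v x)\<bar> \<le> e ^ k" by simp
    qed
  qed
qed

lemma colombeau_compose_abs:
  fixes A :: "gen_real^'n::finite^'n"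
  assumes A: "A \<in> SO" and u: "u \<in> moderate_nets"
    and m: "\<And>i j. (\<lambda>\<epsilon>. a \<epsilon> $ i $ j) \<in> moderate_real"
    and Aa: "\<And>i j. A $ i $ j = abs_gen_real (\<lambda>\<epsilon>. a \<epsilon> $ i $ j)"
  shows "colombeau_compose (abs_colombeau u) A = abs_colombeau (\<lambda>\<epsilon> x. u \<epsilon> (a \<epsilon> *v x))"
proof -
  define b where "b e = map_matrix (\<lambda>r. rep_gen_real r e) A" for e
  define v where "v = rep_colombeau (abs_colombeau u)"
  have bm: "(\<lambda>e. b e $ i $ j) \<in> moderate_real" for i j
    by (simp add: b_def rep_gen_real_moderate)
  have bA: "A $ i $ j = abs_gen_real (\<lambda>e. b e $ i $ j)" for i j
    by (simp add: b_def abs_rep_gen_real)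
  have la: "loc_bounded a" and lb: "loc_bounded b"
    unfolding loc_bounded_def using SO_entries_bounded[OF A m Aa] SO_entries_bounded[OF A bm bA] .
  have ba: "(\<lambda>e. b e $ i $ j - a e $ i $ j) \<in> negligible_real" for i j
    using Aa[of i j] bA[of i j] abs_gen_real_eq_iff[OF bm[of i j] m[of i j]] by simp
  have "colombeau_rel v u" unfolding v_def by (rule rep_abs_colombeau[OF u])
  then have v: "v \<in> moderate_nets" and vu: "loc_negligible (\<lambda>e x. v e x - u e x)"
    by (auto simp: colombeau_rel_iff)
  have "loc_negligible (\<lambda>e x. (v e (b e *v x) - u e (b e *v x)) + (u e (b e *v x) - u e (a e *v x)))"
    by (intro loc_negligible_add loc_negligible_compose_diff la lb ba u loc_negligible_compose[OF lb vu])
  then have "colombeau_rel (\<lambda>e x. v e (b e *v x)) (\<lambda>e x. u e (a e *v x))"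
    using moderate_nets_compose[OF lb bm v] moderate_nets_compose[OF la m u]
    by (simp add: colombeau_rel_iff)
  then have "abs_colombeau (\<lambda>e x. v e (b e *v x)) = abs_colombeau (\<lambda>e x. u e (a e *v x))"
    by (rule Quotient3_rel_abs[OF Quotient3_colombeau])
  then show ?thesis
    by (simp add: colombeau_compose_def v_def b_def)
qed

lemma SO_of_real:
  fixes A :: "real^'n::finite^'n"
  assumes "A \<in> SO"
  shows "(map_matrix of_real A :: gen_real^'n^'n) \<in> SO"
proof -
  let ?B = "map_matrix of_real A :: gen_real^'n^'n"
  have "(transpose ?B ** ?B) $ i $ j = (mat 1 :: gen_real^'n^'n) $ i $ j" for i j
  proof -
    have "(transpose ?B ** ?B) $ i $ j = of_real ((transpose A ** A) $ i $ j)"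
      by (simp add: matrix_matrix_mult_def transpose_def)
    then show ?thesis using assms by (simp add: SO_def mat_def)
  qed
  then have "transpose ?B ** ?B = mat 1" by (simp add: vec_eq_iff)
  moreover have "det ?B = of_real (det A)"
    by (simp add: det_def)
  ultimately show ?thesis using assms by (simp add: SO_def)
qed

lemma colombeau_compose_of_real:
  fixes A :: "real^'n::finite^'n"
  assumes "A \<in> SO" "u \<in> moderate_nets"
  shows "colombeau_compose (abs_colombeau u) (map_matrix of_real A) = abs_colombeau (\<lambda>\<epsilon> x. u \<epsilon> (A *v x))"
  by (rule colombeau_compose_abs[OF SO_of_real[OF assms(1)] assms(2)]) (simp_all add: of_real_gen_real)

end

theory Submission
  imports Defs
begin

text \<open>
  If all standard rotations leave \<open>u\<close> invariant, Baire's theorem makes the negligibility of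
  \<open>u\<^sub>\<epsilon> \<circ> A\<^sub>t - u\<^sub>\<epsilon>\<close> uniform for \<open>t\<close> near \<open>0\<close> along each one-parameter group \<open>A\<^sub>t\<close> of plane rotations, and
  a difference quotient with step a high power of \<open>\<epsilon>\<close> shows that the generator annihilates \<open>u\<close>.
  If the generators annihilate \<open>u\<close>, integration along great circles shows that \<open>u\<^sub>\<epsilon>\<close> is constant on
  spheres up to a negligible error (in dimension at least 2). Hence \<open>u\<^sub>\<epsilon>(x)\<close> can be replaced by
  \<open>f\<^sub>\<epsilon>(|x|)\<close>, where \<open>f\<^sub>\<epsilon>\<close> is the even part of the restriction of \<open>u\<^sub>\<epsilon>\<close> to a coordinate axis. This net is
  smooth and moderate because \<open>\<partial>\<^sub>i (f(|x|)) = x\<^sub>i h(|x|)\<close>, where \<open>h(r) = f'(r) / r\<close> is again even,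
  smooth and controlled by \<open>f''\<close>. Finally, a generalized rotation changes norms only negligibly, so an
  invariant representative is unchanged up to a Lipschitz error.
\<close>

section \<open>Rotations in a plane\<close>

text \<open>For an orthonormal pair this is the velocity field of the rotation turning
  \<open>a\<close> towards \<open>b\<close>.\<close>

definition plane_field :: "'a::real_inner \<Rightarrow> 'a \<Rightarrow> 'a \<Rightarrow> 'a" where
  "plane_field a b x = (x \<bullet> a) *\<^sub>R b - (x \<bullet> b) *\<^sub>R a"

text \<open>The exponential of \<open>t\<close> times the plane field for an orthonormal pair:
  rotation by the angle \<open>t\<close> in the span of \<open>a\<close> and \<open>b\<close>,
  identity on its orthogonal complement. The coordinate-free form makes every great circle an orbit,
  not only those in coordinate planes.\<close>

definition plane_rotation :: "'a::real_inner \<Rightarrow> 'a \<Rightarrow> real \<Rightarrow> 'a \<Rightarrow> 'a" where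
  "plane_rotation a b t x =
     x + (cos t - 1) *\<^sub>R ((x \<bullet> a) *\<^sub>R a + (x \<bullet> b) *\<^sub>R b) + sin t *\<^sub>R plane_field a b x"

definition orthonormal_pair :: "'a::real_inner \<Rightarrow> 'a \<Rightarrow> bool" where
  "orthonormal_pair a b \<longleftrightarrow> a \<bullet> a = 1 \<and> b \<bullet> b = 1 \<and> a \<bullet> b = 0"

lemma linear_plane_rotation: "linear (plane_rotation a b t)"
  by (rule linearI) (simp_all add: plane_rotation_def plane_field_def algebra_simps)

lemma
  assumes "orthonormal_pair a b"
  shows plane_rotation_inner_left: "plane_rotation a b t x \<bullet> a = cos t * (x \<bullet> a) - sin t * (x \<bullet> b)"
    and plane_rotation_inner_right: "plane_rotation a b t x \<bullet> b = cos t * (x \<bullet> b) + sin t * (x \<bullet> a)"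
  using assms
  by (simp_all add: orthonormal_pair_def plane_rotation_def plane_field_def inner_commute[of b a]
      algebra_simps)

lemma plane_rotation_0 [simp]: "plane_rotation a b 0 x = x"
  by (simp add: plane_rotation_def)

text \<open>In the coordinates \<open>x \<bullet> a\<close> and \<open>x \<bullet> b\<close> the map
  is the usual two-dimensional rotation, so the group law is the addition theorem for sine and
  cosine.\<close>

lemma plane_rotation_add:
  assumes "orthonormal_pair a b"
  shows "plane_rotation a b s (plane_rotation a b t x) = plane_rotation a b (s + t) x"
proof -
  define p q where "p = x \<bullet> a" and "q = x \<bullet> b"
  have 1: "plane_rotation a b r y = y + ((cos r - 1) * (y \<bullet> a) - sin r * (y \<bullet> b)) *\<^sub>R a
      + ((cos r - 1) * (y \<bullet> b) + sin r * (y \<bullet> a)) *\<^sub>R b" for r y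
    by (simp add: plane_rotation_def plane_field_def algebra_simps)
  show ?thesis
    unfolding 1[of s "plane_rotation a b t x"] plane_rotation_inner_left[OF assms]
      plane_rotation_inner_right[OF assms]
    unfolding 1 p_def[symmetric] q_def[symmetric] cos_add sin_add
    by (simp add: algebra_simps)
qed

lemma norm_plane_rotation:
  assumes "orthonormal_pair a b"
  shows "norm (plane_rotation a b t x) = norm x"
proof -
  define p q y where "p = x \<bullet> a" and "q = x \<bullet> b" and "y = plane_rotation a b t x"
  have "y = x + ((cos t - 1) * p - sin t * q) *\<^sub>R a + ((cos t - 1) * q + sin t * p) *\<^sub>R b"
    by (simp add: y_def p_def q_def plane_rotation_def plane_field_def algebra_simps)
  then have "y \<bullet> y = x \<bullet> y + ((cos t - 1) * p - sin t * q) * (y \<bullet> a) + ((cos t - 1) * q + sin t * p) * (y \<bullet> b)"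
    by (metis inner_add_left inner_scaleR_left inner_commute)
  moreover have "x \<bullet> y = x \<bullet> x + ((cos t - 1) * p - sin t * q) * p + ((cos t - 1) * q + sin t * p) * q"
    by (simp add: y_def p_def q_def plane_rotation_def plane_field_def algebra_simps)
  moreover have "y \<bullet> a = cos t * p - sin t * q" "y \<bullet> b = cos t * q + sin t * p"
    by (simp_all add: y_def p_def q_def plane_rotation_inner_left[OF assms] plane_rotation_inner_right[OF assms])
  ultimately have "y \<bullet> y = x \<bullet> x + ((cos t - 1) * p - sin t * q) * p + ((cos t - 1) * q + sin t * p) * q
      + ((cos t - 1) * p - sin t * q) * (cos t * p - sin t * q)
      + ((cos t - 1) * q + sin t * p) * (cos t * q + sin t * p)"
    by simp
  \<comment> \<open>The whole change of the squared norm is a multiple of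
    \<open>sin t * sin t + cos t * cos t - 1\<close>.\<close>
  also have "\<dots> = x \<bullet> x + (sin t * sin t + cos t * cos t - 1) * (p * p + q * q)"
    by algebra
  also have "sin t * sin t + cos t * cos t = 1"
    using sin_cos_squared_add[of t] by (simp add: power2_eq_square)
  finally show ?thesis by (simp add: y_def norm_eq)
qed

lemma matrix_plane_rotation_SO:
  fixes a b :: "real^'n::finite"
  assumes "orthonormal_pair a b"
  shows "matrix (plane_rotation a b t) \<in> SO"
proof -
  \<comment> \<open>The determinant is \<open>\<plusminus>1\<close>; it is positive because a rotation is the square of the one by half the angle.\<close>
  have o: "orthogonal_transformation (plane_rotation a b s)" for s
    by (simp add: orthogonal_transformation linear_plane_rotation norm_plane_rotation[OF assms])
  then have om: "orthogonal_matrix (matrix (plane_rotation a b s))" for s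
    using orthogonal_transformation_matrix by blast
  have "plane_rotation a b t = plane_rotation a b (t / 2) \<circ> plane_rotation a b (t / 2)"
    by (simp add: fun_eq_iff plane_rotation_add[OF assms])
  then have "matrix (plane_rotation a b t) = matrix (plane_rotation a b (t / 2)) ** matrix (plane_rotation a b (t / 2))"
    by (metis matrix_compose linear_plane_rotation)
  then have "det (matrix (plane_rotation a b t)) = 1"
    using det_orthogonal_matrix[OF om[of "t / 2"]] by (auto simp: det_mul)
  then show ?thesis
    using om[of t] by (simp add: SO_def orthogonal_matrix)
qed

lemma matrix_plane_rotation: "matrix (plane_rotation a b t) *v x = plane_rotation a b t x"
  for x :: "real^'n::finite"
  by (simp add: linear_plane_rotation matrix_works)

section \<open>Differentiation along curves tangent to a vector field\<close>

lemma has_derivative_compose_vf: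
  fixes F :: "real^'n::finite \<Rightarrow> real"
  assumes "F differentiable (at (g t))" "(g has_vector_derivative \<xi> (g t)) (at t)"
  shows "((\<lambda>t. F (g t)) has_real_derivative vf_deriv \<xi> F (g t)) (at t)"
proof -
  have "(g has_derivative (\<lambda>s. s *\<^sub>R \<xi> (g t))) (at t)"
    using assms(2) by (simp add: has_vector_derivative_def)
  from has_derivative_compose[OF this differentiable_has_derivative_partial[OF assms(1)]]
  have "((\<lambda>t. F (g t)) has_derivative (\<lambda>s. \<Sum>i\<in>UNIV. (s *\<^sub>R \<xi> (g t)) $ i * partial_deriv i F (g t))) (at t)" .
  also have "(\<lambda>s. \<Sum>i\<in>UNIV. (s *\<^sub>R \<xi> (g t)) $ i * partial_deriv i F (g t)) = (*) (vf_deriv \<xi> F (g t))"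
    by (rule ext) (simp add: vf_deriv_def sum_distrib_left sum_distrib_right mult_ac)
  finally show ?thesis by (simp add: has_field_derivative_def)
qed

text \<open>The velocity is the field at the moving point, so orbits are integral curves and
  differentiating twice along an orbit applies the field twice.\<close>

lemma plane_rotation_has_vector_derivative:
  assumes "orthonormal_pair a b"
  shows "((\<lambda>t. plane_rotation a b t x) has_vector_derivative plane_field a b (plane_rotation a b t x)) (at t)"
proof -
  have "((\<lambda>t. plane_rotation a b t x) has_vector_derivative
      (- sin t) *\<^sub>R ((x \<bullet> a) *\<^sub>R a + (x \<bullet> b) *\<^sub>R b) + cos t *\<^sub>R plane_field a b x) (at t)"
    unfolding plane_rotation_def
    by (auto intro!: derivative_eq_intros simp: has_vector_derivative_def algebra_simps)
  also have "(- sin t) *\<^sub>R ((x \<bullet> a) *\<^sub>R a + (x \<bullet> b) *\<^sub>R b) + cos t *\<^sub>R plane_field a b x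
      = plane_field a b (plane_rotation a b t x)"
    unfolding plane_field_def plane_rotation_inner_left[OF assms] plane_rotation_inner_right[OF assms]
    by (simp add: algebra_simps)
  finally show ?thesis .
qed

lemma plane_rotation_has_real_derivative:
  fixes F :: "real^'n::finite \<Rightarrow> real"
  assumes "orthonormal_pair a b" "\<And>y. F differentiable (at y)"
  shows "((\<lambda>t. F (plane_rotation a b t x)) has_real_derivative
      vf_deriv (plane_field a b) F (plane_rotation a b t x)) (at t)"
  by (intro has_derivative_compose_vf assms plane_rotation_has_vector_derivative)

section \<open>Plane fields as combinations of the coordinate rotation fields\<close>

lemma rotation_field_eq_plane_field: "rotation_field i j = plane_field (axis i 1) (axis j 1)"
  by (simp add: fun_eq_iff rotation_field_def plane_field_def inner_axis)

text \<open>The plane field is bilinear in \<open>a\<close> and \<open>b\<close>, and both are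
  expanded along the axes. Estimates for the finitely many coordinate fields thereby carry over to
  all great circles.\<close>

lemma plane_field_eq_sum_rotation_field:
  "plane_field a b x = (\<Sum>i\<in>UNIV. \<Sum>j\<in>UNIV. (a $ i * b $ j) *\<^sub>R rotation_field i j x)"
  for x :: "real^'n::finite"
proof -
  have "plane_field a b x $ k = (\<Sum>i\<in>UNIV. \<Sum>j\<in>UNIV. (a $ i * b $ j) *\<^sub>R rotation_field i j x) $ k" for k
  proof -
  have d: "(\<Sum>j\<in>UNIV. c $ j * (axis j 1 :: real^'n) $ k) = c $ k" for c :: "real^'n"
    by (simp add: axis_def if_distrib[of "\<lambda>t. _ * t"] cong: if_cong)
  have "(\<Sum>i\<in>UNIV. \<Sum>j\<in>UNIV. (a $ i * b $ j) *\<^sub>R rotation_field i j x) $ k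
    = (\<Sum>i\<in>UNIV. \<Sum>j\<in>UNIV. (x $ i * a $ i) * (b $ j * (axis j 1 :: real^'n) $ k)
        - (a $ i * (axis i 1 :: real^'n) $ k) * (x $ j * b $ j))"
    by (simp add: rotation_field_def algebra_simps)
  also have "\<dots> = (x \<bullet> a) * b $ k - a $ k * (x \<bullet> b)"
    unfolding sum_subtractf sum_product[symmetric] d by (simp add: inner_vec_def)
  finally show "plane_field a b x $ k = (\<Sum>i\<in>UNIV. \<Sum>j\<in>UNIV. (a $ i * b $ j) *\<^sub>R rotation_field i j x) $ k"
    by (simp add: plane_field_def)
  qed
  then show ?thesis by (simp add: vec_eq_iff)
qed

lemma vf_deriv_sum_scaleR:
  "vf_deriv (\<lambda>x. \<Sum>i\<in>I. c i *\<^sub>R \<xi> i x) F x = (\<Sum>i\<in>I. c i * vf_deriv (\<xi> i) F x)"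
proof -
  have "vf_deriv (\<lambda>x. \<Sum>i\<in>I. c i *\<^sub>R \<xi> i x) F x = (\<Sum>k\<in>UNIV. \<Sum>i\<in>I. c i * (\<xi> i x $ k * partial_deriv k F x))"
    by (simp add: vf_deriv_def sum_distrib_right mult.assoc)
  also have "\<dots> = (\<Sum>i\<in>I. \<Sum>k\<in>UNIV. c i * (\<xi> i x $ k * partial_deriv k F x))"
    by (rule sum.swap)
  finally show ?thesis by (simp add: vf_deriv_def sum_distrib_left)
qed

lemma vf_deriv_rotation_generator:
  "vf_deriv (\<lambda>x. \<Sum>i\<in>UNIV. \<Sum>j\<in>UNIV. c i j *\<^sub>R rotation_field i j x) F x
     = (\<Sum>i\<in>UNIV. \<Sum>j\<in>UNIV. c i j * vf_deriv (rotation_field i j) F x)"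
  using vf_deriv_sum_scaleR[where I=UNIV and c="\<lambda>_. 1" and F=F and x=x
      and \<xi>="\<lambda>i x. \<Sum>j\<in>UNIV. c i j *\<^sub>R rotation_field i j x"]
  by (simp add: vf_deriv_sum_scaleR)

lemma rotation_field_in_generators: "rotation_field i j \<in> rotation_generators"
proof -
  have "rotation_field i j = (\<lambda>x. \<Sum>i'\<in>UNIV. \<Sum>j'\<in>UNIV.
      ((axis i 1 :: real^'a) $ i' * (axis j 1 :: real^'a) $ j') *\<^sub>R rotation_field i' j' x)"
    by (simp add: fun_eq_iff rotation_field_eq_plane_field[of i j] plane_field_eq_sum_rotation_field)
  then show ?thesis
    unfolding rotation_generators_def
    by (intro CollectI exI[of _ "\<lambda>i' j'. (axis i 1 :: real^'a) $ i' * (axis j 1 :: real^'a) $ j'"]) simp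
qed

text \<open>With \<open>a\<close> the direction of \<open>x\<close>, Gram-Schmidt applied to
  \<open>y\<close> yields \<open>b\<close>; the angle consists of the polar coordinates of
  \<open>y\<close> in this plane. The bound on \<open>\<theta>\<close> limits the length of the
  arc.\<close>

lemma great_circle_exists:
  fixes x y :: "real^'n::finite"
  assumes n: "2 \<le> CARD('n)" and xy: "norm x = norm y"
  obtains a b \<theta> where "orthonormal_pair a b" "0 \<le> \<theta>" "\<theta> \<le> 2 * pi" "y = plane_rotation a b \<theta> x"
proof (cases "x = 0")
  case True
  obtain a :: "real^'n" where a: "norm a = 1" using vector_choose_size[of 1] by auto
  obtain b :: "real^'n" where "b \<noteq> 0" "orthogonal a b"
    using orthogonal_to_vector_exists[of a] n by auto
  then have "orthonormal_pair a (b /\<^sub>R norm b)"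
    using a by (simp add: orthonormal_pair_def orthogonal_def norm_eq_1 dot_square_norm field_simps power2_eq_square)
  moreover have "y = plane_rotation a (b /\<^sub>R norm b) 0 x" using True xy by simp
  ultimately show ?thesis using that[of a "b /\<^sub>R norm b" 0] by simp
next
  case False
  define r where "r = norm x"
  have r: "r > 0" using False by (simp add: r_def)
  define a where "a = x /\<^sub>R r"
  have a: "a \<bullet> a = 1" using r by (simp add: a_def r_def dot_square_norm power2_eq_square)
  have x: "x = r *\<^sub>R a" using r by (simp add: a_def)
  define z where "z = y - (y \<bullet> a) *\<^sub>R a"
  have za: "z \<bullet> a = 0" by (simp add: z_def inner_diff_left a)
  \<comment> \<open>If \<open>y\<close> is parallel to \<open>x\<close>, any unit vector orthogonal
    to \<open>a\<close> serves; its existence uses dimension at least 2.\<close>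
  obtain b where b: "b \<bullet> b = 1" "a \<bullet> b = 0" and zb: "z = norm z *\<^sub>R b"
  proof (cases "z = 0")
    case True
    obtain b :: "real^'n" where "b \<noteq> 0" "orthogonal a b"
      using orthogonal_to_vector_exists[of a] n by auto
    then show ?thesis using True
      by (intro that[of "b /\<^sub>R norm b"]) (auto simp: orthogonal_def dot_square_norm field_simps power2_eq_square)
  next
    case False
    then show ?thesis using za
      by (intro that[of "z /\<^sub>R norm z"]) (auto simp: inner_commute dot_square_norm field_simps power2_eq_square)
  qed
  have ab: "orthonormal_pair a b" using a b by (simp add: orthonormal_pair_def)
  have y: "y = (y \<bullet> a) *\<^sub>R a + norm z *\<^sub>R b"
    unfolding zb[symmetric] by (simp add: z_def)
  have "y \<bullet> y = (y \<bullet> a) * (y \<bullet> a) + norm z * (y \<bullet> b)"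
    using arg_cong[OF y, of "\<lambda>v. v \<bullet> y"] by (simp add: inner_add_left inner_add_right inner_commute)
  also have "y \<bullet> b = norm z" using arg_cong[OF y, of "\<lambda>v. v \<bullet> b"] b by (simp add: inner_add_left)
  finally have "(y \<bullet> a)\<^sup>2 + (norm z)\<^sup>2 = r\<^sup>2"
    using xy by (simp add: r_def dot_square_norm power2_eq_square)
  then have "((y \<bullet> a) / r)\<^sup>2 + (norm z / r)\<^sup>2 = 1"
    using r by (simp add: power_divide add_divide_distrib[symmetric])
  then obtain t where t: "0 \<le> t" "t < 2 * pi" "(y \<bullet> a) / r = cos t" "norm z / r = sin t"
    by (rule sincos_total_2pi)
  then have "y \<bullet> a = r * cos t" "norm z = r * sin t" using r by (auto simp: field_simps)
  moreover have "plane_rotation a b t x = (r * cos t) *\<^sub>R a + (r * sin t) *\<^sub>R b"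
    using a b by (simp add: x plane_rotation_def plane_field_def algebra_simps)
  ultimately have "y = plane_rotation a b t x" using y by metis
  then show ?thesis using that[OF ab t(1)] t(2) by simp
qed

section \<open>Invariance under standard rotations\<close>

lemma smooth_plane_field: "smooth (\<lambda>x::real^'n::finite. plane_field a b x $ k)"
  by (rule smooth_linear, rule linearI) (simp_all add: plane_field_def algebra_simps)

lemma smooth_continuous_plane_rotation:
  fixes a b :: "real^'n::finite"
  assumes "orthonormal_pair a b" "smooth F"
  shows "continuous_on S (\<lambda>t. F (plane_rotation a b t x))"
  using plane_rotation_has_real_derivative[OF assms(1) smooth_differentiable[OF assms(2)]]
  by (intro continuous_at_imp_continuous_on ballI DERIV_isCont) blast

text \<open>
  For each angle separately the estimate holds below some threshold for \<open>\<epsilon>\<close>. By Baire's theorem one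
  threshold serves an interval of angles, which the group law moves to \<open>0\<close>.
\<close>

lemma negligible_plane_rotation_uniform:
  fixes a b :: "real^'n::finite"
  assumes ab: "orthonormal_pair a b" and u: "\<And>e. e \<in> {0<..1} \<Longrightarrow> smooth (u e)"
    and neg: "\<And>t. loc_negligible (\<lambda>e x. u e (plane_rotation a b t x) - u e x)"
  obtains h where "0 < h"
    "\<forall>\<^sub>F e in at_right 0. \<forall>s\<in>{0..h}. \<forall>x\<in>cball 0 R. \<bar>u e (plane_rotation a b s x) - u e x\<bar> \<le> 2 * e ^ k"
proof -
  define d :: "nat \<Rightarrow> real" where "d m = inverse (real (Suc m))" for m
  \<comment> \<open>The bound by 1 keeps the thresholds in the range where \<open>u e\<close> is
    smooth, which the closedness of \<open>F m\<close> relies on.\<close>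
  have d: "0 < d m" "d m \<le> 1" for m
    by (auto simp: d_def field_simps)
  define F where "F m = {t. \<forall>e\<in>{0<..<d m}. \<forall>x\<in>cball 0 R.
      \<bar>u e (plane_rotation a b t x) - u e x\<bar> \<le> e ^ k}" for m
  have F_closed: "closed (F m)" for m
  proof -
    have "F m = (\<Inter>e\<in>{0<..<d m}. \<Inter>x\<in>cball 0 R. {t. \<bar>u e (plane_rotation a b t x) - u e x\<bar> \<le> e ^ k})"
      by (auto simp: F_def)
    also have "closed \<dots>"
      using d[of m]
      by (intro closed_INT ballI closed_Collect_le continuous_intros
          smooth_continuous_plane_rotation[OF ab] u) auto
    finally show ?thesis .
  qed
  have F_cover: "\<exists>m. t \<in> F m" for t
  proof -
    have "\<forall>\<^sub>F e in at_right 0. \<forall>x\<in>cball 0 R. \<bar>u e (plane_rotation a b t x) - u e x\<bar> \<le> e ^ k"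
      using neg[of t] unfolding loc_negligible_def by (meson compact_cball)
    then obtain c where c: "c > 0"
      "\<And>e. 0 < e \<Longrightarrow> e < c \<Longrightarrow> \<forall>x\<in>cball 0 R. \<bar>u e (plane_rotation a b t x) - u e x\<bar> \<le> e ^ k"
      unfolding eventually_at_right_field by blast
    obtain m where "d m < c" using reals_Archimedean[OF c(1)] by (auto simp: d_def)
    then show ?thesis using c(2) by (intro exI[of _ m]) (auto simp: F_def)
  qed
  have "\<exists>m. interior (F m) \<noteq> {}"
  proof (rule ccontr)
    \<comment> \<open>Otherwise countably many closed sets with empty interior would cover the real
      line.\<close>
    assume "\<nexists>m. interior (F m) \<noteq> {}"
    then have "euclideanreal interior_of \<Union>(range F) = {}"
      by (intro Baire_category_alt)
        (auto simp: completely_metrizable_space_euclidean F_closed interior_of_def interior_def)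
    moreover have "\<Union>(range F) = UNIV" using F_cover by auto
    ultimately show False by (metis UNIV_not_empty interior_of_topspace topspace_euclidean)
  qed
  then obtain m t0 where "t0 \<in> interior (F m)" by blast
  then obtain r where r: "r > 0" "ball t0 r \<subseteq> F m" by (auto simp: mem_interior)
  have *: "t0 + s \<in> F m" if "0 \<le> s" "s \<le> r / 2" for s
    using r that by (auto simp: dist_real_def)
  have "\<forall>\<^sub>F e in at_right 0. \<forall>s\<in>{0..r / 2}. \<forall>x\<in>cball 0 R. \<bar>u e (plane_rotation a b s x) - u e x\<bar> \<le> 2 * e ^ k"
    using eventually_at_right_real[OF d(1)[of m]]
  proof eventually_elim
    case (elim e)
    show ?case
    proof (intro ballI)
      fix s and x :: "real^'n" assume s: "s \<in> {0..r / 2}" and x: "x \<in> cball 0 R"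
      \<comment> \<open>Rotating \<open>x\<close> back by \<open>t0\<close>, which stays in the
        ball, turns the angles \<open>s\<close> and \<open>0\<close> at \<open>x\<close> into
        \<open>t0 + s\<close> and \<open>t0\<close> at \<open>y\<close>. Both lie in
        \<open>F m\<close>, and the triangle inequality produces the factor 2.\<close>
      define y where "y = plane_rotation a b (- t0) x"
      have y: "y \<in> cball 0 R" using x by (simp add: y_def norm_plane_rotation[OF ab])
      have "t0 + s \<in> F m" "t0 + 0 \<in> F m" using * s r by auto
      then have "\<bar>u e (plane_rotation a b (t0 + s) y) - u e y\<bar> \<le> e ^ k"
        "\<bar>u e (plane_rotation a b t0 y) - u e y\<bar> \<le> e ^ k"
        using elim y by (auto simp: F_def)
      moreover have "plane_rotation a b (t0 + s) y = plane_rotation a b s x" "plane_rotation a b t0 y = x"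
        by (simp_all add: y_def plane_rotation_add[OF ab])
      ultimately show "\<bar>u e (plane_rotation a b s x) - u e x\<bar> \<le> 2 * e ^ k" by simp
    qed
  qed
  then show ?thesis using r by (intro that[of "r / 2"]) auto
qed

text \<open>The difference quotient equals \<open>f'\<close> at some intermediate point, and
  returning from there to 0 costs at most \<open>B * h\<close>. A small \<open>A\<close> thus beats
  a large \<open>B\<close> once \<open>h\<close> is chosen suitably.\<close>

lemma derivative_estimate:
  fixes f :: "real \<Rightarrow> real"
  assumes h: "0 < h"
    and f: "\<And>t. (f has_real_derivative f' t) (at t)" "\<And>t. (f' has_real_derivative f'' t) (at t)"
    and A: "\<bar>f h - f 0\<bar> \<le> A" and B: "\<And>t. 0 \<le> t \<Longrightarrow> t \<le> h \<Longrightarrow> \<bar>f'' t\<bar> \<le> B"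
  shows "\<bar>f' 0\<bar> \<le> A / h + B * h"
proof -
  obtain s where s: "0 < s" "s < h" "f h - f 0 = (h - 0) * f' s"
    using MVT2[OF h, of f f'] f(1) by blast
  obtain r where r: "0 < r" "r < s" "f' s - f' 0 = (s - 0) * f'' r"
    using MVT2[OF s(1), of f' f''] f(2) by blast
  have "\<bar>f' s\<bar> \<le> A / h" using A s(3) h by (simp add: abs_mult field_simps)
  moreover have "\<bar>f' s - f' 0\<bar> \<le> h * B"
    unfolding r(3) abs_mult using r s B[of r] by (intro mult_mono) auto
  ultimately show ?thesis by (simp add: mult.commute)
qed

text \<open>The field applied to \<open>u\<close> is the derivative at angle 0 along orbits. The
  second derivative is moderate and the increment is negligible uniformly in small angles, so a step
  that shrinks with \<open>e\<close> is allowed.\<close>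

lemma loc_negligible_plane_field:
  fixes u :: "real \<Rightarrow> real^'n::finite \<Rightarrow> real"
  assumes ab: "orthonormal_pair a b" and u: "u \<in> moderate_nets"
    and neg: "\<And>t. loc_negligible (\<lambda>e x. u e (plane_rotation a b t x) - u e x)"
  shows "loc_negligible (\<lambda>e. vf_deriv (plane_field a b) (u e))"
  unfolding loc_negligible_def
proof (intro allI impI)
  fix K :: "(real^'n) set" and k assume K: "compact K"
  obtain R where R: "K \<subseteq> cball 0 R"
    using compact_imp_bounded[OF K] unfolding bounded_iff by (auto simp: subset_eq)
  let ?X = "vf_deriv (plane_field a b)"
  have u': "(\<lambda>e. ?X (u e)) \<in> moderate_nets" by (intro moderate_nets_vf_deriv smooth_plane_field u)
  then have "(\<lambda>e. ?X (?X (u e))) \<in> moderate_nets"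
    by (rule moderate_nets_vf_deriv[OF smooth_plane_field])
  then obtain p where p: "\<forall>\<^sub>F e in at_right 0. \<forall>x\<in>cball 0 R. \<bar>?X (?X (u e)) x\<bar> \<le> 1 / e ^ p"
    using moderate_nets_loc_moderate compact_cball unfolding loc_moderate_def by blast
  \<comment> \<open>With step \<open>e ^ q\<close> the second-derivative term becomes
    \<open>e ^ (k + 1)\<close>; an increment of order \<open>q + k + 1\<close> contributes
    \<open>2 * e ^ (k + 1)\<close>. Their sum is at most \<open>e ^ k\<close> for \<open>e\<close>
    up to 1/3.\<close>
  define q where "q = p + k + 1"
  have smooth_u: "smooth (u e)" if "e \<in> {0<..1}" for e using u that by (auto simp: moderate_nets_iff)
  obtain h where h: "0 < h" "\<forall>\<^sub>F e in at_right 0. \<forall>s\<in>{0..h}. \<forall>x\<in>cball 0 R.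
      \<bar>u e (plane_rotation a b s x) - u e x\<bar> \<le> 2 * e ^ (q + k + 1)"
    using negligible_plane_rotation_uniform[OF ab smooth_u neg] by blast
  show "\<forall>\<^sub>F e in at_right 0. \<forall>x\<in>K. \<bar>?X (u e) x\<bar> \<le> e ^ k"
    using h(2) p eventually_small[OF h(1)] eventually_small[of "1 / 3", simplified]
  proof eventually_elim
    case (elim e)
    have e: "e \<in> {0<..1}" using elim by auto
    \<comment> \<open>The step must stay in the interval of angles where the uniform estimate holds;
      \<open>q\<close> is at least 1 and \<open>e\<close> is at most \<open>h\<close>.\<close>
    have "e ^ q \<le> e ^ 1" using elim by (intro power_decreasing) (auto simp: q_def)
    then have eq: "0 < e ^ q" "e ^ q \<le> h" using elim by auto
    show ?case
    proof
      fix x assume "x \<in> K"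
      then have x: "x \<in> cball 0 R" using R by blast
      let ?g = "\<lambda>t. plane_rotation a b t x"
      have "\<bar>?X (u e) (?g 0)\<bar> \<le> 2 * e ^ (q + k + 1) / e ^ q + (1 / e ^ p) * e ^ q"
      proof (rule derivative_estimate[where f = "\<lambda>t. u e (?g t)" and f' = "\<lambda>t. ?X (u e) (?g t)"
            and f'' = "\<lambda>t. ?X (?X (u e)) (?g t)"])
        show "((\<lambda>t. u e (?g t)) has_real_derivative ?X (u e) (?g t)) (at t)" for t
          by (intro plane_rotation_has_real_derivative ab smooth_differentiable smooth_u e)
        have "smooth (?X (u e))" using u' e by (auto simp: moderate_nets_iff)
        then show "((\<lambda>t. ?X (u e) (?g t)) has_real_derivative ?X (?X (u e)) (?g t)) (at t)" for t
          by (intro plane_rotation_has_real_derivative ab smooth_differentiable)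
        show "\<bar>u e (?g (e ^ q)) - u e (?g 0)\<bar> \<le> 2 * e ^ (q + k + 1)"
          using elim(1) eq x by auto
        show "\<bar>?X (?X (u e)) (?g t)\<bar> \<le> 1 / e ^ p" for t
          using elim(2) x by (simp add: norm_plane_rotation[OF ab])
      qed (use eq in auto)
      also have "2 * e ^ (q + k + 1) / e ^ q + (1 / e ^ p) * e ^ q = (3 * e) * e ^ k"
        using elim by (simp add: q_def power_add field_simps)
      also have "\<dots> \<le> 1 * e ^ k"
        using elim by (intro mult_right_mono) auto
      finally show "\<bar>?X (u e) x\<bar> \<le> e ^ k" by simp
    qed
  qed
qed

section \<open>Passage between generalized functions and representatives\<close>

lemma colombeau_obtain_rep:
  fixes w :: "'n::finite colombeau"
  obtains u where "u \<in> moderate_nets" "w = abs_colombeau u"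
proof -
  have "rep_colombeau w \<in> moderate_nets"
    using Quotient3_rep_reflp[OF Quotient3_colombeau, of w] by (simp add: colombeau_rel_def)
  then show ?thesis using that Quotient3_abs_rep[OF Quotient3_colombeau, of w] by metis
qed

lemma vf_deriv_abs_eq_0_iff:
  assumes "\<And>k. smooth (\<lambda>x. \<xi> x $ k)" "u \<in> moderate_nets"
  shows "colombeau_vf_deriv \<xi> (abs_colombeau u) = 0 \<longleftrightarrow> loc_negligible (\<lambda>e. vf_deriv \<xi> (u e))"
proof -
  have "(\<lambda>e. vf_deriv \<xi> (u e)) \<in> moderate_nets" by (rule moderate_nets_vf_deriv[OF assms])
  then show ?thesis
    unfolding colombeau_vf_deriv_abs[OF assms] zero_colombeau.abs_eq
    by (simp add: abs_colombeau_eq_iff moderate_nets_real negligible_nets_iff)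
qed

lemma loc_negligible_scale: "loc_negligible u \<Longrightarrow> loc_negligible (\<lambda>e x. c * u e x)"
  using loc_negligible_mult[OF _ loc_moderate_const[of "\<lambda>_. c"]] by (simp add: mult.commute)

text \<open>Generators are linear combinations of rotation fields, and for distinct indices these
  are plane fields of orthonormal pairs, whose rotations are standard. For equal indices the field
  vanishes.\<close>

lemma compose_invariant_imp_vf_deriv_0:
  fixes u :: "'n::finite colombeau"
  assumes inv: "\<forall>A \<in> (SO :: (real^'n^'n) set). colombeau_compose u (map_matrix of_real A) = u"
    and \<xi>: "\<xi> \<in> rotation_generators"
  shows "colombeau_vf_deriv \<xi> u = 0"
proof -
  obtain w where w: "w \<in> moderate_nets" "u = abs_colombeau w" by (rule colombeau_obtain_rep)
  have neg: "loc_negligible (\<lambda>e x. w e (A *v x) - w e x)" if A: "A \<in> SO" for A :: "real^'n^'n"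
  proof -
    have "abs_colombeau (\<lambda>e x. w e (A *v x)) = abs_colombeau w"
      using inv A colombeau_compose_of_real[OF A w(1)] w(2) by simp
    moreover have "(\<lambda>e x. w e (A *v x)) \<in> moderate_nets"
    proof (rule moderate_nets_compose)
      \<comment> \<open>The bound for generalized rotations is applied to the constant net of
        \<open>A\<close>.\<close>
      have "\<forall>\<^sub>F e in at_right (0::real). \<forall>i j. \<bar>A $ i $ j\<bar> \<le> 2"
        using SO_entries_bounded[OF SO_of_real[OF A], of "\<lambda>_. A"] by (simp add: of_real_gen_real)
      then show "loc_bounded (\<lambda>_. A)" by (simp add: loc_bounded_def)
    qed (use w in auto)
    ultimately show ?thesis using w(1) by (simp add: abs_colombeau_eq_iff negligible_nets_iff)
  qed
  have rf: "loc_negligible (\<lambda>e. vf_deriv (rotation_field i j) (w e))" for i j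
  proof (cases "i = j")
    case True
    then show ?thesis by (simp add: vf_deriv_def[abs_def] rotation_field_def loc_negligible_0)
  next
    case False
    then have ab: "orthonormal_pair (axis i 1 :: real^'n) (axis j 1)"
      by (simp add: orthonormal_pair_def inner_axis_axis)
    show ?thesis
      unfolding rotation_field_eq_plane_field
      using neg[OF matrix_plane_rotation_SO[OF ab]]
      by (intro loc_negligible_plane_field ab w) (simp add: matrix_plane_rotation)
  qed
  obtain c where \<xi>c: "\<xi> = (\<lambda>x. \<Sum>i\<in>UNIV. \<Sum>j\<in>UNIV. c i j *\<^sub>R rotation_field i j x)"
    using \<xi> by (auto simp: rotation_generators_def)
  have "loc_negligible (\<lambda>e. vf_deriv \<xi> (w e))"
    unfolding \<xi>c vf_deriv_rotation_generator[abs_def]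
    by (intro loc_negligible_sum loc_negligible_scale rf)
  then show ?thesis
    unfolding w(2) by (simp add: vf_deriv_abs_eq_0_iff[OF smooth_rotation_generators[OF \<xi>] w(1)])
qed

section \<open>Radial nets\<close>

text \<open>A net of functions of one variable is carried together with all its derivatives,
  \<open>f j\<close> being the \<open>j\<close>-th. Derived nets can then be given by explicit
  formulas for every order.\<close>

definition moderate_jet :: "(nat \<Rightarrow> real \<Rightarrow> real \<Rightarrow> real) \<Rightarrow> bool" where
  "moderate_jet f \<longleftrightarrow>
     (\<forall>j. \<forall>e\<in>{0<..1}. \<forall>r. (f j e has_real_derivative f (Suc j) e r) (at r)) \<and>
     (\<forall>j R. \<exists>p. \<forall>\<^sub>F e in at_right 0. \<forall>r. \<bar>r\<bar> \<le> R \<longrightarrow> \<bar>f j e r\<bar> \<le> 1 / e ^ p)"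

lemma moderate_jet_D:
  assumes "moderate_jet f"
  shows "e \<in> {0<..1} \<Longrightarrow> (f j e has_real_derivative f (Suc j) e r) (at r)"
    and "\<exists>p. \<forall>\<^sub>F e in at_right 0. \<forall>r. \<bar>r\<bar> \<le> R \<longrightarrow> \<bar>f j e r\<bar> \<le> 1 / e ^ p"
  using assms by (auto simp: moderate_jet_def)

lemma moderate_jet_continuous:
  assumes "moderate_jet f" "e \<in> {0<..1}"
  shows "continuous_on S (f j e)"
  by (intro continuous_at_imp_continuous_on ballI DERIV_isCont[OF moderate_jet_D(1)[OF assms]])

text \<open>
  The jet of \<open>r \<mapsto> f'(r) / r = \<integral>\<^sub>0\<^sup>1 f''(s r) ds\<close>, for \<open>f\<close> even.
\<close>

definition jet_quotient :: "(nat \<Rightarrow> real \<Rightarrow> real \<Rightarrow> real) \<Rightarrow> nat \<Rightarrow> real \<Rightarrow> real \<Rightarrow> real" where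
  "jet_quotient f j e r = integral {0..1} (\<lambda>s. s ^ j * f (j + 2) e (s * r))"

text \<open>Each differentiation under the integral sign brings out one factor \<open>s\<close>,
  which explains \<open>s ^ j\<close>. Since \<open>s\<close> runs through the unit interval, a
  bound for \<open>f (j + 2)\<close> on \<open>[-R, R]\<close> passes to the integral.\<close>

lemma moderate_jet_quotient:
  assumes f: "moderate_jet f"
  shows "moderate_jet (jet_quotient f)"
  unfolding moderate_jet_def
proof (intro conjI allI ballI)
  fix j and e r :: real assume e: "e \<in> {0<..1}"
  have c: "continuous_on S (\<lambda>x. f i e (g x))" if "continuous_on S g" for S :: "'x::topological_space set" and g i
    using continuous_on_compose2[OF moderate_jet_continuous[OF f e, of UNIV i] that] by simp
  have "((\<lambda>r. integral (cbox 0 1) (\<lambda>s. s ^ j * f (j + 2) e (s * r))) has_field_derivative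
      integral (cbox 0 1) (\<lambda>s. s ^ Suc j * f (Suc j + 2) e (s * r))) (at r within UNIV)"
  proof (rule leibniz_rule_field_derivative)
    fix x s :: real
    have "((\<lambda>r. f (j + 2) e (s * r)) has_real_derivative f (Suc (j + 2)) e (s * x) * s) (at x)"
      by (rule DERIV_chain'[OF _ moderate_jet_D(1)[OF f e]]) (auto intro!: derivative_eq_intros)
    from DERIV_cmult[OF this, of "s ^ j"]
    show "((\<lambda>r. s ^ j * f (j + 2) e (s * r)) has_field_derivative s ^ Suc j * f (Suc j + 2) e (s * x))
        (at x within UNIV)"
      by (simp add: mult_ac)
  qed (auto intro!: integrable_continuous_real continuous_intros c simp: split_beta)
  then show "(jet_quotient f j e has_real_derivative jet_quotient f (Suc j) e r) (at r)"
    by (simp add: jet_quotient_def[abs_def])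
next
  fix j and R :: real
  obtain p where p: "\<forall>\<^sub>F e in at_right 0. \<forall>r. \<bar>r\<bar> \<le> R \<longrightarrow> \<bar>f (j + 2) e r\<bar> \<le> 1 / e ^ p"
    using moderate_jet_D(2)[OF f] by blast
  have "\<forall>\<^sub>F e in at_right 0. \<forall>r. \<bar>r\<bar> \<le> R \<longrightarrow> \<bar>jet_quotient f j e r\<bar> \<le> 1 / e ^ p"
    using p eventually_small[of 1, simplified]
  proof eventually_elim
    case (elim e)
    then have e: "e \<in> {0<..1}" by auto
    show ?case
    proof (intro allI impI)
      fix r :: real assume r: "\<bar>r\<bar> \<le> R"
      have "norm (integral {0..1} (\<lambda>s. s ^ j * f (j + 2) e (s * r))) \<le> 1 / e ^ p * (1 - 0)"
      proof (rule integral_bound)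
        show "continuous_on {0..1} (\<lambda>s. s ^ j * f (j + 2) e (s * r))"
          by (intro continuous_intros continuous_on_compose2[OF moderate_jet_continuous[OF f e, of UNIV]]) auto
        show "norm (s ^ j * f (j + 2) e (s * r)) \<le> 1 / e ^ p" if s: "s \<in> {0..1}" for s
        proof -
          have "\<bar>s * r\<bar> \<le> 1 * R" unfolding abs_mult using r s by (intro mult_mono) auto
          then have "\<bar>f (j + 2) e (s * r)\<bar> \<le> 1 / e ^ p" using elim(1) by simp
          moreover have "\<bar>s ^ j\<bar> \<le> 1" using s by (simp add: power_abs power_le_one)
          ultimately have "\<bar>s ^ j\<bar> * \<bar>f (j + 2) e (s * r)\<bar> \<le> 1 * (1 / e ^ p)" by (intro mult_mono) auto
          then show ?thesis by (simp add: abs_mult)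
        qed
      qed simp
      then show "\<bar>jet_quotient f j e r\<bar> \<le> 1 / e ^ p" by (simp add: jet_quotient_def)
    qed
  qed
  then show "\<exists>p. \<forall>\<^sub>F e in at_right 0. \<forall>r. \<bar>r\<bar> \<le> R \<longrightarrow> \<bar>jet_quotient f j e r\<bar> \<le> 1 / e ^ p" by blast
qed

section \<open>Parity of jets and differentiability of radial functions\<close>

lemma has_real_derivative_reflect:
  assumes "\<And>r. (f has_real_derivative f' r) (at r)" "\<And>r. f (- r) = c * f r" "c * c = 1"
  shows "f' (- r) = - c * f' r"
proof -
  have "((\<lambda>r. f (- r)) has_real_derivative f' (- r) * - 1) (at r)"
    by (rule DERIV_chain'[OF _ assms(1)]) (auto intro!: derivative_eq_intros)
  moreover have "((\<lambda>r. f (- r)) has_real_derivative c * f' r) (at r)"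
    unfolding assms(2) by (rule DERIV_cmult[OF assms(1)])
  ultimately show ?thesis using DERIV_unique by fastforce
qed

lemma even_jet:
  assumes f: "moderate_jet f" and e: "e \<in> {0<..1}" and even: "\<And>r. f 0 e (- r) = f 0 e r"
  shows "f j e (- r) = (- 1) ^ j * f j e r"
proof (induction j arbitrary: r)
  case (Suc j)
  show ?case
    using has_real_derivative_reflect[OF moderate_jet_D(1)[OF f e] Suc, of r]
    by (simp flip: power_mult_distrib)
qed (simp add: even)

lemma jet_quotient_even:
  assumes "moderate_jet f" "e \<in> {0<..1}" "\<And>r. f 0 e (- r) = f 0 e r"
  shows "jet_quotient f 0 e (- r) = jet_quotient f 0 e r"
  using even_jet[OF assms, of 2] by (simp add: jet_quotient_def numeral_2_eq_2)

text \<open>This is the fundamental theorem of calculus for \<open>f 1 e (s * r)\<close> as a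
  function of \<open>s\<close>; the lower boundary term vanishes because the derivative of an even
  function is odd.\<close>

lemma jet_quotient_times:
  assumes f: "moderate_jet f" and e: "e \<in> {0<..1}" and even: "\<And>r. f 0 e (- r) = f 0 e r"
  shows "r * jet_quotient f 0 e r = f 1 e r"
proof -
  have "((\<lambda>s. f 1 e (s * r)) has_vector_derivative r * f 2 e (s * r)) (at s within {0..1})" for s
  proof -
    have "((\<lambda>s. f 1 e (s * r)) has_real_derivative f (Suc 1) e (s * r) * r) (at s)"
      by (rule DERIV_chain'[OF _ moderate_jet_D(1)[OF f e]]) (auto intro!: derivative_eq_intros)
    then show ?thesis
      by (simp add: numeral_2_eq_2 mult.commute has_real_derivative_iff_has_vector_derivative
          has_vector_derivative_at_within)
  qed
  then have "((\<lambda>s. r * f 2 e (s * r)) has_integral f 1 e (1 * r) - f 1 e (0 * r)) {0..1}"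
    by (intro fundamental_theorem_of_calculus) auto
  moreover have "f 1 e 0 = 0" using even_jet[OF assms, of 1 0] by simp
  ultimately have "((\<lambda>s. r * f 2 e (s * r)) has_integral f 1 e r) {0..1}" by simp
  from integral_unique[OF this] show ?thesis by (simp add: jet_quotient_def numeral_2_eq_2)
qed

text \<open>Away from 0 this is the chain rule with \<open>f'(r)\<close> written as \<open>r\<close>
  times the quotient. At 0 the norm is not differentiable, but \<open>f'(0) = 0\<close> makes the
  increment \<open>o(norm v)\<close>.\<close>

lemma has_derivative_radial:
  fixes x :: "'a::real_inner"
  assumes f: "moderate_jet f" and e: "e \<in> {0<..1}" and even: "\<And>r. f 0 e (- r) = f 0 e r"
  shows "((\<lambda>x. f 0 e (norm x)) has_derivative (\<lambda>v. jet_quotient f 0 e (norm x) * (x \<bullet> v))) (at x)"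
proof (cases "x = 0")
  case False
  have "(f 0 e has_derivative (*) (f 1 e (norm x))) (at (norm x))"
    using moderate_jet_D(1)[OF f e, of 0] by (simp add: has_field_derivative_def)
  from has_derivative_compose[OF has_derivative_norm[OF False] this]
  have "((\<lambda>x. f 0 e (norm x)) has_derivative (\<lambda>v. f 1 e (norm x) * (v \<bullet> sgn x))) (at x)" .
  also have "(\<lambda>v. f 1 e (norm x) * (v \<bullet> sgn x)) = (\<lambda>v. jet_quotient f 0 e (norm x) * (x \<bullet> v))"
    using False jet_quotient_times[OF assms, of "norm x", symmetric]
    by (simp add: fun_eq_iff sgn_div_norm inner_commute)
  finally show ?thesis .
next
  case True
  have "(f 0 e has_derivative (*) (f 1 e 0)) (at 0)"
    using moderate_jet_D(1)[OF f e, of 0] by (simp add: has_field_derivative_def)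
  moreover have "f 1 e 0 = 0" using even_jet[OF assms, of 1 0] by simp
  ultimately have "((\<lambda>t. norm (f 0 e t - f 0 e 0) / norm t) \<longlongrightarrow> 0) (at 0)"
    by (simp add: has_derivative_at)
  \<comment> \<open>The norm tends to 0 without taking the value 0 away from the origin, so it may
    be substituted into the one-variable limit.\<close>
  moreover have "filterlim norm (at (0::real)) (at (0::'a))"
    by (simp add: filterlim_at tendsto_norm_zero eventually_at_filter)
  ultimately have "((\<lambda>v::'a. norm (f 0 e (norm v) - f 0 e 0) / norm (norm v)) \<longlongrightarrow> 0) (at 0)"
    by (rule filterlim_compose)
  then show ?thesis using True by (simp add: has_derivative_at)
qed

text \<open>A partial derivative of the radial net is a coordinate times the radial net of the
  quotient jet. That jet is again even and moderate, so the induction over \<open>m\<close> has to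
  run over all jets.\<close>

lemma moderate_upto_radial:
  assumes "moderate_jet f" "\<And>e r. e \<in> {0<..1} \<Longrightarrow> f 0 e (- r) = f 0 e r"
  shows "moderate_upto m (\<lambda>e (x::real^'n::finite). f 0 e (norm x))"
  using assms
proof (induction m arbitrary: f)
  case 0
  have "loc_moderate (\<lambda>e (x::real^'n). f 0 e (norm x))"
    unfolding loc_moderate_def
  proof (intro allI impI)
    fix K :: "(real^'n) set" assume K: "compact K"
    obtain R where R: "\<And>x. x \<in> K \<Longrightarrow> norm x \<le> R"
      using compact_imp_bounded[OF K] unfolding bounded_iff by blast
    obtain p where "\<forall>\<^sub>F e in at_right 0. \<forall>r. \<bar>r\<bar> \<le> R \<longrightarrow> \<bar>f 0 e r\<bar> \<le> 1 / e ^ p"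
      using moderate_jet_D(2)[OF 0(1)] by blast
    then have "\<forall>\<^sub>F e in at_right 0. \<forall>x\<in>K. \<bar>f 0 e (norm x)\<bar> \<le> 1 / e ^ p"
      by eventually_elim (use R in auto)
    then show "\<exists>p. \<forall>\<^sub>F e in at_right 0. \<forall>x\<in>K. \<bar>f 0 e (norm x)\<bar> \<le> 1 / e ^ p" by blast
  qed
  moreover have "(\<lambda>x::real^'n. f 0 e (norm x)) differentiable (at x)" if "e \<in> {0<..1}" for e x
    using has_derivative_radial[OF 0(1) that 0(2)[OF that]] unfolding differentiable_def by blast
  ultimately show ?case by simp
next
  case (Suc m)
  have "moderate_upto m (\<lambda>e. partial_deriv i (\<lambda>x::real^'n. f 0 e (norm x)))" for i :: 'n
  proof -
    have "smooth (\<lambda>x::real^'n. x $ i)" by (intro smooth_linear linearI) auto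
    then have "moderate_upto m (\<lambda>e (x::real^'n). x $ i)"
      using moderate_nets_smooth moderate_nets_upto by blast
    moreover have "moderate_upto m (\<lambda>e (x::real^'n). jet_quotient f 0 e (norm x))"
      using Suc.prems by (intro Suc.IH moderate_jet_quotient jet_quotient_even)
    ultimately have "moderate_upto m (\<lambda>e (x::real^'n). jet_quotient f 0 e (norm x) * x $ i)"
      by (intro moderate_upto_mult)
    then show ?thesis
    proof (rule moderate_upto_cong[rotated], intro ballI ext)
      fix e and x :: "real^'n" assume e: "e \<in> {0<..1::real}"
      show "jet_quotient f 0 e (norm x) * x $ i = partial_deriv i (\<lambda>x::real^'n. f 0 e (norm x)) x"
        using partial_deriv_eq[OF has_derivative_radial[OF Suc.prems(1) e Suc.prems(2)[OF e]], of i]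
        by (simp add: inner_axis)
    qed
  qed
  \<comment> \<open>Order 0 is already contained in the induction hypothesis for \<open>f\<close>
    itself.\<close>
  moreover have "moderate_upto 0 (\<lambda>e (x::real^'n). f 0 e (norm x))"
    using moderate_upto_D[OF Suc.IH[OF Suc.prems]] by simp
  ultimately show ?case by simp
qed

text \<open>Reflection contributes a factor -1 per differentiation. Symmetrizing supplies the
  evenness required of radial profiles, which the restriction of a representative to an axis need
  not have.\<close>

lemma moderate_jet_even_part:
  assumes f: "moderate_jet f"
  shows "moderate_jet (\<lambda>j e r. (f j e r + (- 1) ^ j * f j e (- r)) / 2)"
  unfolding moderate_jet_def
proof (intro conjI allI ballI)
  fix j and e r :: real assume e: "e \<in> {0<..1}"
  have "((\<lambda>r. f j e (- r)) has_real_derivative f (Suc j) e (- r) * - 1) (at r)"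
    by (rule DERIV_chain'[OF _ moderate_jet_D(1)[OF f e]]) (auto intro!: derivative_eq_intros)
  from DERIV_cdivide[OF DERIV_add[OF moderate_jet_D(1)[OF f e, of j r]
      DERIV_cmult[OF this, of "(- 1) ^ j"]], of 2]
  show "((\<lambda>r. (f j e r + (- 1) ^ j * f j e (- r)) / 2) has_real_derivative
      (f (Suc j) e r + (- 1) ^ Suc j * f (Suc j) e (- r)) / 2) (at r)" by simp
next
  fix j R
  obtain p where "\<forall>\<^sub>F e in at_right 0. \<forall>r. \<bar>r\<bar> \<le> R \<longrightarrow> \<bar>f j e r\<bar> \<le> 1 / e ^ p"
    using moderate_jet_D(2)[OF f] by blast
  then have "\<forall>\<^sub>F e in at_right 0. \<forall>r. \<bar>r\<bar> \<le> R \<longrightarrow> \<bar>(f j e r + (- 1) ^ j * f j e (- r)) / 2\<bar> \<le> 1 / e ^ p"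
  proof eventually_elim
    case (elim e)
    show ?case
    proof (intro allI impI)
      fix r assume "\<bar>r\<bar> \<le> R"
      then have "\<bar>f j e r\<bar> \<le> 1 / e ^ p" "\<bar>(- 1) ^ j * f j e (- r)\<bar> \<le> 1 / e ^ p"
        using elim by (auto simp: abs_mult)
      from abs_triangle_ineq[THEN order_trans, OF add_mono[OF this]]
      show "\<bar>(f j e r + (- 1) ^ j * f j e (- r)) / 2\<bar> \<le> 1 / e ^ p" by simp
    qed
  qed
  then show "\<exists>p. \<forall>\<^sub>F e in at_right 0. \<forall>r. \<bar>r\<bar> \<le> R \<longrightarrow> \<bar>(f j e r + (- 1) ^ j * f j e (- r)) / 2\<bar> \<le> 1 / e ^ p"
    by blast
qed

lemma moderate_jet_axis:
  fixes u :: "real \<Rightarrow> real^'n::finite \<Rightarrow> real"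
  assumes u: "u \<in> moderate_nets"
  shows "moderate_jet (\<lambda>j e r. (partial_deriv i ^^ j) (u e) (r *\<^sub>R axis i 1))"
proof -
  have m: "(\<lambda>e. (partial_deriv i ^^ j) (u e)) \<in> moderate_nets" for j
    by (induction j) (auto intro: u moderate_nets_partial_deriv)
  show ?thesis
    unfolding moderate_jet_def
  proof (intro conjI allI ballI)
    fix j and e r :: real assume "e \<in> {0<..1}"
    then have "smooth ((partial_deriv i ^^ j) (u e))" using m by (auto simp: moderate_nets_iff)
    then have "((\<lambda>r. (partial_deriv i ^^ j) (u e) (r *\<^sub>R axis i 1)) has_real_derivative
        vf_deriv (\<lambda>_. axis i 1) ((partial_deriv i ^^ j) (u e)) (r *\<^sub>R axis i 1)) (at r)"
      by (intro has_derivative_compose_vf smooth_differentiable)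
        (auto simp: has_vector_derivative_def intro!: derivative_eq_intros)
    also have "vf_deriv (\<lambda>_. axis i 1) F x = partial_deriv i F x" for F :: "real^'n \<Rightarrow> real" and x
      by (simp add: vf_deriv_def axis_def if_distrib[of "\<lambda>a. a * _"] cong: if_cong)
    finally show "((\<lambda>r. (partial_deriv i ^^ j) (u e) (r *\<^sub>R axis i 1)) has_real_derivative
        (partial_deriv i ^^ Suc j) (u e) (r *\<^sub>R axis i 1)) (at r)" by simp
  next
    fix j R
    obtain p where "\<forall>\<^sub>F e in at_right 0. \<forall>x\<in>cball 0 R. \<bar>(partial_deriv i ^^ j) (u e) x\<bar> \<le> 1 / e ^ p"
      using moderate_nets_loc_moderate[OF m] compact_cball unfolding loc_moderate_def by blast
    then have "\<forall>\<^sub>F e in at_right 0. \<forall>r. \<bar>r\<bar> \<le> R \<longrightarrow> \<bar>(partial_deriv i ^^ j) (u e) (r *\<^sub>R axis i 1)\<bar> \<le> 1 / e ^ p"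
      by eventually_elim simp
    then show "\<exists>p. \<forall>\<^sub>F e in at_right 0. \<forall>r. \<bar>r\<bar> \<le> R \<longrightarrow>
        \<bar>(partial_deriv i ^^ j) (u e) (r *\<^sub>R axis i 1)\<bar> \<le> 1 / e ^ p" by blast
  qed
qed

section \<open>Annihilation by the generators\<close>

text \<open>The two points are joined by a great circle arc of angle at most \<open>2 * pi\<close>.
  The derivative along it is a combination of the coordinate fields whose coefficients
  \<open>a $ i * b $ j\<close> are at most 1 in absolute value.\<close>

lemma sphere_oscillation_bound:
  fixes F :: "real^'n::finite \<Rightarrow> real"
  assumes n: "2 \<le> CARD('n)" and F: "\<And>z. F differentiable (at z)"
    and B: "\<And>i j z. norm z = norm x \<Longrightarrow> \<bar>vf_deriv (rotation_field i j) F z\<bar> \<le> B"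
    and xy: "norm x = norm y"
  shows "\<bar>F x - F y\<bar> \<le> 2 * pi * (real CARD('n) * real CARD('n) * B)"
proof -
  obtain a b \<theta> where ab: "orthonormal_pair a b" and \<theta>: "0 \<le> \<theta>" "\<theta> \<le> 2 * pi" "y = plane_rotation a b \<theta> x"
    by (rule great_circle_exists[OF n xy])
  have B0: "0 \<le> B" using B[of x] abs_ge_zero order_trans by blast
  have unit: "\<bar>a $ i\<bar> \<le> 1" "\<bar>b $ i\<bar> \<le> 1" for i
    using ab component_le_norm_cart[of a i] component_le_norm_cart[of b i]
    by (auto simp: orthonormal_pair_def norm_eq_sqrt_inner)
  have X: "\<bar>vf_deriv (plane_field a b) F z\<bar> \<le> real CARD('n) * real CARD('n) * B" if z: "norm z = norm x" for z
  proof -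
    have "vf_deriv (plane_field a b) F z = (\<Sum>i\<in>UNIV. \<Sum>j\<in>UNIV. a $ i * b $ j * vf_deriv (rotation_field i j) F z)"
      unfolding plane_field_eq_sum_rotation_field[abs_def] by (rule vf_deriv_rotation_generator)
    also have "\<bar>\<dots>\<bar> \<le> (\<Sum>i\<in>(UNIV::'n set). \<Sum>j\<in>(UNIV::'n set). B)"
    proof (intro order_trans[OF sum_abs] sum_mono)
      fix i j
      have "\<bar>a $ i * b $ j\<bar> \<le> 1 * 1" unfolding abs_mult using unit by (intro mult_mono) auto
      then have "\<bar>a $ i * b $ j\<bar> * \<bar>vf_deriv (rotation_field i j) F z\<bar> \<le> 1 * B"
        using B[OF z] by (intro mult_mono) auto
      then show "\<bar>a $ i * b $ j * vf_deriv (rotation_field i j) F z\<bar> \<le> B" by (simp add: abs_mult)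
    qed
    finally show ?thesis by simp
  qed
  have "norm (F (plane_rotation a b \<theta> x) - F (plane_rotation a b 0 x)) \<le>
      real CARD('n) * real CARD('n) * B * norm (\<theta> - 0)"
  proof (rule field_differentiable_bound[where S = UNIV])
    show "((\<lambda>t. F (plane_rotation a b t x)) has_field_derivative
        vf_deriv (plane_field a b) F (plane_rotation a b t x)) (at t within UNIV)" for t
      using plane_rotation_has_real_derivative[OF ab F] by simp
  qed (auto simp: X norm_plane_rotation[OF ab])
  also have "\<dots> \<le> real CARD('n) * real CARD('n) * B * (2 * pi)"
    using \<theta> B0 by (intro mult_left_mono) auto
  finally show ?thesis using \<theta>(3) by (simp add: abs_minus_commute mult_ac)
qed

text \<open>The oscillation bound is the same for all pairs of points on a sphere, so any
  norm-preserving \<open>g\<close> is covered. It serves to compare \<open>x\<close> with the two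
  points of equal norm on a coordinate axis.\<close>

lemma loc_negligible_sphere:
  fixes u :: "real \<Rightarrow> real^'n::finite \<Rightarrow> real"
  assumes n: "2 \<le> CARD('n)" and u: "u \<in> moderate_nets"
    and neg: "\<And>i j. loc_negligible (\<lambda>e. vf_deriv (rotation_field i j) (u e))"
    and g: "\<And>x. norm (g x) = norm x"
  shows "loc_negligible (\<lambda>e x. u e x - u e (g x))"
  unfolding loc_negligible_def
proof (intro allI impI)
  fix K :: "(real^'n) set" and k assume K: "compact K"
  obtain R where R: "\<And>x. x \<in> K \<Longrightarrow> norm x \<le> R"
    using compact_imp_bounded[OF K] unfolding bounded_iff by blast
  \<comment> \<open>The constant is absorbed by the extra factor in \<open>e ^ Suc k\<close> as soon
    as \<open>e\<close> is at most \<open>1 / c\<close>.\<close>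
  define c where "c = 2 * pi * (real CARD('n) * real CARD('n))"
  have c: "0 < 1 / c" by (simp add: c_def)
  have "\<forall>\<^sub>F e in at_right 0. \<forall>z\<in>cball 0 R. \<bar>vf_deriv (rotation_field i j) (u e) z\<bar> \<le> e ^ Suc k" for i j
    using neg[of i j] compact_cball unfolding loc_negligible_def by blast
  then have "\<forall>\<^sub>F e in at_right 0. \<forall>i j. \<forall>z\<in>cball 0 R. \<bar>vf_deriv (rotation_field i j) (u e) z\<bar> \<le> e ^ Suc k"
    by (intro eventually_all_finite)
  then show "\<forall>\<^sub>F e in at_right 0. \<forall>x\<in>K. \<bar>u e x - u e (g x)\<bar> \<le> e ^ k"
    using eventually_small[OF c]
  proof eventually_elim
    case (elim e)
    show ?case
    proof
      fix x assume x: "x \<in> K"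
      have "\<bar>u e x - u e (g x)\<bar> \<le> 2 * pi * (real CARD('n) * real CARD('n) * e ^ Suc k)"
      proof (rule sphere_oscillation_bound[OF n])
        show "u e differentiable (at z)" for z
          using u elim by (auto simp: moderate_nets_iff intro: smooth_differentiable)
      qed (use elim R[OF x] g in auto)
      also have "\<dots> = (c * e) * e ^ k" by (simp add: c_def)
      also have "\<dots> \<le> 1 * e ^ k"
        using elim c by (intro mult_right_mono) (auto simp: field_simps)
      finally show "\<bar>u e x - u e (g x)\<bar> \<le> e ^ k" by simp
    qed
  qed
qed

section \<open>Rotation matrices and the construction of an invariant representative\<close>

lemma norm_SO_mult:
  fixes A :: "real^'n::finite^'n"
  assumes "A \<in> SO"
  shows "norm (A *v x) = norm x"
proof -
  have "orthogonal_matrix A" using assms by (simp add: SO_def orthogonal_matrix)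
  then have "orthogonal_transformation ((*v) A)"
    by (simp add: orthogonal_transformation_matrix matrix_of_matrix_vector_mul)
  then show ?thesis by (rule orthogonal_transformation_norm)
qed

text \<open>The determinant is the only entry. Dimension 1 is treated apart because spheres of
  positive radius there are pairs of points that no rotation interchanges.\<close>

lemma SO_card_1:
  fixes A :: "'a::comm_ring_1^'n::finite^'n"
  assumes n: "CARD('n) = 1" and A: "A \<in> SO"
  shows "A = mat 1"
proof -
  obtain k :: 'n where U: "UNIV = {k}" using n card_1_singletonE by blast
  have "det A = A $ k $ k" unfolding det_def by (simp add: U)
  then have "A $ k $ k = 1" using A by (simp add: SO_def)
  moreover have "i = k" for i using U by auto
  ultimately show ?thesis by (metis (mono_tags, lifting) mat_def vec_eq_iff vec_lambda_beta)
qed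

text \<open>The new representative depends on \<open>x\<close> only through its norm and is
  therefore exactly invariant; the evenness of its profile secures smoothness at the origin. In
  dimension 1 every representative is invariant.\<close>

lemma vf_deriv_0_imp_invariant_representative:
  fixes u :: "'n::finite colombeau"
  assumes 0: "\<forall>\<xi> \<in> rotation_generators. colombeau_vf_deriv \<xi> u = 0"
  shows "\<exists>v \<in> moderate_nets. abs_colombeau v = u \<and> (\<forall>\<epsilon>\<in>{0<..1}. rotation_invariant (v \<epsilon>))"
proof -
  obtain w where w: "w \<in> moderate_nets" "u = abs_colombeau w" by (rule colombeau_obtain_rep)
  show ?thesis
  proof (cases "CARD('n) = 1")
    case True
    then show ?thesis
      using w by (intro bexI[of _ w]) (auto simp: rotation_invariant_def dest!: SO_card_1[OF True])
  next
    case False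
    moreover have "CARD('n) > 0" by simp
    ultimately have n: "2 \<le> CARD('n)" by linarith
    have neg: "loc_negligible (\<lambda>e. vf_deriv (rotation_field i j) (w e))" for i j
      using 0[rule_format, OF rotation_field_in_generators, of i j] unfolding w(2)
      by (simp only: vf_deriv_abs_eq_0_iff[OF smooth_rotation_generators[OF rotation_field_in_generators] w(1)])
    fix i :: 'n
    define v where "v e x = (w e (norm x *\<^sub>R axis i 1) + w e (- norm x *\<^sub>R axis i 1)) / 2" for e and x :: "real^'n"
    have "v \<in> moderate_nets"
      unfolding moderate_nets_upto
    proof
      fix m
      show "moderate_upto m v"
        using moderate_upto_radial[OF moderate_jet_even_part[OF moderate_jet_axis[OF w(1), of i]], of m]
        by (simp add: v_def[abs_def] add.commute)
    qed
    moreover have "loc_negligible (\<lambda>e x. v e x - w e x)"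
    proof -
      \<comment> \<open>The difference \<open>v - w\<close> is minus the mean of the deviations of
        \<open>w\<close> from its values at the two axis points on the sphere through
        \<open>x\<close>.\<close>
      have "loc_negligible (\<lambda>e x. (- 1 / 2) * ((w e x - w e (norm x *\<^sub>R axis i 1)) + (w e x - w e (- norm x *\<^sub>R axis i 1))))"
        by (intro loc_negligible_scale loc_negligible_add loc_negligible_sphere n w neg) auto
      then show ?thesis by (rule loc_negligible_cong[rotated]) (auto simp: v_def field_simps)
    qed
    ultimately have "abs_colombeau v = u"
      unfolding w(2) using w(1) by (simp add: abs_colombeau_eq_iff negligible_nets_iff moderate_nets_diff)
    moreover have "rotation_invariant (v e)" for e
      by (auto simp: rotation_invariant_def v_def fun_eq_iff norm_SO_mult)
    ultimately show ?thesis using \<open>v \<in> moderate_nets\<close> by blast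
  qed
qed

section \<open>Generalized rotations\<close>

text \<open>The gradient bound on a ball gives a Lipschitz constant. The exponents of the finitely
  many partial derivatives are replaced by their maximum, and one further power of
  \<open>1 / e\<close> absorbs the dimension.\<close>

lemma moderate_nets_lipschitz:
  fixes u :: "real \<Rightarrow> real^'n::finite \<Rightarrow> real"
  assumes u: "u \<in> moderate_nets"
  shows "\<exists>p. \<forall>\<^sub>F e in at_right 0. \<forall>x\<in>cball 0 R. \<forall>y\<in>cball 0 R. \<bar>u e x - u e y\<bar> \<le> norm (x - y) / e ^ p"
proof -
  have "\<exists>p. \<forall>\<^sub>F e in at_right 0. \<forall>x\<in>cball 0 R. \<bar>partial_deriv i (u e) x\<bar> \<le> 1 / e ^ p" for i
    using moderate_nets_loc_moderate[OF moderate_nets_partial_deriv[OF u]] compact_cball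
    unfolding loc_moderate_def by blast
  then obtain P where P: "\<And>i. \<forall>\<^sub>F e in at_right 0. \<forall>x\<in>cball 0 R. \<bar>partial_deriv i (u e) x\<bar> \<le> 1 / e ^ P i"
    using choice[of "\<lambda>i p. \<forall>\<^sub>F e in at_right 0. \<forall>x\<in>cball 0 R. \<bar>partial_deriv i (u e) x\<bar> \<le> 1 / e ^ p"] by blast
  define p where "p = Max (range P)"
  have p: "P i \<le> p" for i by (simp add: p_def)
  have "\<forall>\<^sub>F e in at_right 0. \<forall>i. \<forall>x\<in>cball 0 R. \<bar>partial_deriv i (u e) x\<bar> \<le> 1 / e ^ P i"
    by (intro eventually_all_finite P)
  then have "\<forall>\<^sub>F e in at_right 0. \<forall>x\<in>cball 0 R. \<forall>y\<in>cball 0 R.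
      \<bar>u e x - u e y\<bar> \<le> norm (x - y) / e ^ Suc p"
    using eventually_small[of "1 / real CARD('n)", simplified]
  proof eventually_elim
    case (elim e)
    show ?case
    proof (intro ballI)
      fix x y :: "real^'n" assume xy: "x \<in> cball 0 R" "y \<in> cball 0 R"
      have "\<bar>u e x - u e y\<bar> \<le> real CARD('n) * (1 / e ^ p) * norm (x - y)"
      proof (rule differentiable_lipschitz_cball[OF _ _ xy])
        show "u e differentiable (at z)" for z
          using u elim by (auto simp: moderate_nets_iff intro: smooth_differentiable)
        show "\<bar>partial_deriv i (u e) z\<bar> \<le> 1 / e ^ p" if "z \<in> cball 0 R" for z i
          using elim that inverse_power_mono[OF _ _ p[of i], of e] by (meson order_trans)
      qed
      also have "\<dots> \<le> (1 / e) * (1 / e ^ p) * norm (x - y)"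
        using elim by (intro mult_right_mono) (auto simp: field_simps)
      finally show "\<bar>u e x - u e y\<bar> \<le> norm (x - y) / e ^ Suc p" by simp
    qed
  qed
  then show ?thesis by blast
qed

text \<open>Rotations act transitively on spheres in dimension at least 2.\<close>

lemma rotation_invariant_norm_eq:
  fixes f :: "real^'n::finite \<Rightarrow> real"
  assumes "2 \<le> CARD('n)" "rotation_invariant f" "norm x = norm y"
  shows "f x = f y"
proof -
  obtain g :: "real^'n \<Rightarrow> real^'n" where g: "orthogonal_transformation g" "det (matrix g) = 1" "g x = y"
    by (rule rotation_exists[OF assms(1,3)])
  then have "matrix g \<in> SO" "matrix g *v x = y"
    by (auto simp: SO_def orthogonal_transformation_matrix orthogonal_matrix matrix_works)
  then show ?thesis using assms(2) unfolding rotation_invariant_def by metis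
qed

text \<open>Orthogonality over the generalized numbers holds on representatives only up to a
  negligible error; the individual matrices \<open>a e\<close> need not be orthogonal.\<close>

lemma SO_gram_negligible:
  fixes A :: "gen_real^'n::finite^'n"
  assumes A: "A \<in> SO" and m: "\<And>i j. (\<lambda>e. a e $ i $ j) \<in> moderate_real"
    and Aa: "\<And>i j. A $ i $ j = abs_gen_real (\<lambda>e. a e $ i $ j)"
  shows "(\<lambda>e. (transpose (a e) ** a e - mat 1) $ i $ j) \<in> negligible_real"
proof -
  have mod: "(\<lambda>e. \<Sum>k\<in>UNIV. a e $ k $ i * a e $ k $ j) \<in> moderate_real"
    by (intro moderate_real_sum moderate_real_mult m)
  have "abs_gen_real (\<lambda>e. \<Sum>k\<in>UNIV. a e $ k $ i * a e $ k $ j) = (\<Sum>k\<in>UNIV. A $ k $ i * A $ k $ j)"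
    by (subst abs_gen_real_sum)
      (auto simp: Aa times_gen_real.abs_eq gen_real_rel_refl m intro: moderate_real_mult)
  also have "\<dots> = (transpose A ** A) $ i $ j"
    by (simp add: matrix_matrix_mult_def transpose_def)
  also have "\<dots> = abs_gen_real (\<lambda>_. if i = j then 1 else 0)"
    using A by (simp add: SO_def mat_def one_gen_real.abs_eq zero_gen_real.abs_eq)
  finally have "(\<lambda>e. (\<Sum>k\<in>UNIV. a e $ k $ i * a e $ k $ j) - (if i = j then 1 else 0)) \<in> negligible_real"
    unfolding abs_gen_real_eq_iff[OF mod moderate_real_const] .
  then show ?thesis
    by (simp add: matrix_matrix_mult_def transpose_def mat_def)
qed

section \<open>Effect of approximately orthogonal matrices on norms and invariant nets\<close>

lemma norm_sq_matrix_vector_diff: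
  fixes a :: "real^'n::finite^'n"
  shows "(norm (a *v x))\<^sup>2 - (norm x)\<^sup>2 = ((transpose a ** a - mat 1) *v x) \<bullet> x"
proof -
  have "(a *v x) \<bullet> (a *v x) = ((transpose a ** a) *v x) \<bullet> x"
    by (metis dot_lmul_matrix matrix_vector_mul_assoc transpose_matrix_vector)
  then show ?thesis
    by (simp add: power2_norm_eq_inner matrix_vector_mult_diff_rdistrib inner_diff_left)
qed

text \<open>For nonnegative numbers the square of a difference is at most the difference of squares
  in absolute value, which here is the quadratic form of the Gram defect. This avoids dividing by
  norms and is uniform near the origin.\<close>

lemma SO_norm_negligible:
  fixes A :: "gen_real^'n::finite^'n"
  assumes A: "A \<in> SO" and m: "\<And>i j. (\<lambda>e. a e $ i $ j) \<in> moderate_real"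
    and Aa: "\<And>i j. A $ i $ j = abs_gen_real (\<lambda>e. a e $ i $ j)"
  shows "\<forall>\<^sub>F e in at_right 0. \<forall>x\<in>cball 0 R. \<bar>norm (a e *v x) - norm x\<bar> \<le> e ^ k"
proof -
  \<comment> \<open>Using \<open>\<bar>R\<bar> + 1\<close> keeps \<open>c\<close> positive for every
    real \<open>R\<close>.\<close>
  define c where "c = real CARD('n) * real CARD('n) * (\<bar>R\<bar> + 1)\<^sup>2"
  have c: "0 < 1 / c" by (simp add: c_def add_nonneg_pos)
  \<comment> \<open>The exponent is doubled because a square root follows; the additional power
    absorbs \<open>c\<close>.\<close>
  have "\<forall>\<^sub>F e in at_right 0. \<forall>i j. \<bar>(transpose (a e) ** a e - mat 1) $ i $ j\<bar> \<le> e ^ (2 * k + 1)"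
    by (intro eventually_all_finite SO_gram_negligible[OF A m Aa, unfolded negligible_real_iff, rule_format])
  then show ?thesis
    using eventually_small[OF c]
  proof eventually_elim
    case (elim e)
    show ?case
    proof
      fix x :: "real^'n" assume "x \<in> cball 0 R"
      then have x: "norm x \<le> \<bar>R\<bar> + 1" by simp
      let ?G = "transpose (a e) ** a e - mat 1"
      let ?n = "real CARD('n)"
      have "\<bar>norm (a e *v x) - norm x\<bar> * \<bar>norm (a e *v x) - norm x\<bar> \<le>
          \<bar>norm (a e *v x) - norm x\<bar> * \<bar>norm (a e *v x) + norm x\<bar>"
        using norm_ge_zero[of "a e *v x"] norm_ge_zero[of x] by (intro mult_left_mono) linarith+
      also have "\<dots> = \<bar>(?G *v x) \<bullet> x\<bar>"
        unfolding norm_sq_matrix_vector_diff[symmetric] abs_mult[symmetric] power2_eq_square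
          square_diff_square_factored
        by (simp only: mult.commute)
      also have "\<dots> \<le> norm (?G *v x) * norm x" by (rule Cauchy_Schwarz_ineq2)
      also have "\<dots> \<le> (?n * ?n * e ^ (2 * k + 1) * norm x) * norm x"
        using elim by (intro mult_right_mono norm_matrix_vector_le) auto
      also have "\<dots> = ?n * ?n * e ^ (2 * k + 1) * (norm x)\<^sup>2" by (simp add: power2_eq_square)
      also have "\<dots> \<le> ?n * ?n * e ^ (2 * k + 1) * (\<bar>R\<bar> + 1)\<^sup>2"
        using elim x by (intro mult_left_mono power_mono) auto
      also have "\<dots> = (c * e) * (e ^ k)\<^sup>2" by (simp add: c_def power_mult power_even_eq mult_ac)
      also have "\<dots> \<le> 1 * (e ^ k)\<^sup>2"
        using elim c by (intro mult_right_mono) (auto simp: field_simps)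
      finally have "\<bar>norm (a e *v x) - norm x\<bar>\<^sup>2 \<le> (e ^ k)\<^sup>2" by (simp add: power2_eq_square)
      then show "\<bar>norm (a e *v x) - norm x\<bar> \<le> e ^ k"
        by (rule power2_le_imp_le) (use elim in auto)
    qed
  qed
qed

text \<open>By invariance \<open>a e *v x\<close> may be replaced by the point \<open>z\<close> on
  the ray of \<open>x\<close> with the same norm. That point is negligibly close to
  \<open>x\<close>, and the moderate Lipschitz constant preserves negligibility.\<close>

lemma loc_negligible_invariant_compose:
  fixes A :: "gen_real^'n::finite^'n"
  assumes A: "A \<in> SO" and m: "\<And>i j. (\<lambda>e. a e $ i $ j) \<in> moderate_real"
    and Aa: "\<And>i j. A $ i $ j = abs_gen_real (\<lambda>e. a e $ i $ j)"
    and n: "2 \<le> CARD('n)" and u: "u \<in> moderate_nets" and inv: "\<And>e. e \<in> {0<..1} \<Longrightarrow> rotation_invariant (u e)"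
  shows "loc_negligible (\<lambda>e x. u e (a e *v x) - u e x)"
  unfolding loc_negligible_def
proof (intro allI impI)
  fix K :: "(real^'n) set" and k assume K: "compact K"
  obtain R where R: "\<And>x. x \<in> K \<Longrightarrow> norm x \<le> R"
    using compact_imp_bounded[OF K] unfolding bounded_iff by blast
  \<comment> \<open>The radius \<open>R + 1\<close> leaves room for \<open>z\<close>, whose distance
    from \<open>x\<close> will be at most 1.\<close>
  obtain p where p: "\<forall>\<^sub>F e in at_right 0. \<forall>x\<in>cball 0 (R + 1). \<forall>y\<in>cball 0 (R + 1).
      \<bar>u e x - u e y\<bar> \<le> norm (x - y) / e ^ p"
    using moderate_nets_lipschitz[OF u, of "R + 1"] by (elim exE) (rule that)
  show "\<forall>\<^sub>F e in at_right 0. \<forall>x\<in>K. \<bar>u e (a e *v x) - u e x\<bar> \<le> e ^ k"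
    using p SO_norm_negligible[OF A m Aa, of R "k + p"] eventually_small[of 1, simplified]
  proof eventually_elim
    case (elim e)
    show ?case
    proof
      fix x assume "x \<in> K"
      then have x: "norm x \<le> R" by (rule R)
      \<comment> \<open>At the origin the quotient is \<open>0 / 0 = 0\<close>, and
        \<open>z = 0\<close> still has the norm of \<open>a e *v x\<close>.\<close>
      define z where "z = (norm (a e *v x) / norm x) *\<^sub>R x"
      have z: "norm z = norm (a e *v x)" by (simp add: z_def)
      have "norm (z - x) = \<bar>norm (a e *v x) - norm x\<bar>"
      proof (cases "x = 0")
        case False
        have "z - x = (norm (a e *v x) / norm x - 1) *\<^sub>R x" by (simp add: z_def algebra_simps)
        then have "norm (z - x) = \<bar>(norm (a e *v x) / norm x - 1) * norm x\<bar>" by (simp add: abs_mult)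
        also have "(norm (a e *v x) / norm x - 1) * norm x = norm (a e *v x) - norm x"
          using False by (simp add: left_diff_distrib)
        finally show ?thesis .
      qed (simp add: z_def)
      also have "\<dots> \<le> e ^ (k + p)" using elim x by simp
      finally have zx: "norm (z - x) \<le> e ^ (k + p)" .
      also have "\<dots> \<le> 1" using elim by (intro power_le_one) auto
      finally have "norm z \<le> R + 1" using x norm_triangle_ineq[of x "z - x"] by simp
      then have "\<bar>u e z - u e x\<bar> \<le> norm (z - x) / e ^ p" using elim x by simp
      also have "\<dots> \<le> e ^ (k + p) / e ^ p" using zx elim by (intro divide_right_mono) auto
      also have "\<dots> = e ^ k" using elim by (simp add: power_add)
      also have "u e z = u e (a e *v x)"
        using elim by (intro rotation_invariant_norm_eq[where f = "u e", OF n inv z]) auto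
      finally show "\<bar>u e (a e *v x) - u e x\<bar> \<le> e ^ k" .
    qed
  qed
qed

text \<open>In dimension 1 the matrix is the identity and has a constant representative; in higher
  dimensions the Lipschitz comparison along rays applies.\<close>

lemma invariant_representative_imp_compose:
  fixes v :: "real \<Rightarrow> real^'n::finite \<Rightarrow> real" and A :: "gen_real^'n^'n"
  assumes v: "v \<in> moderate_nets" and inv: "\<forall>e\<in>{0<..1}. rotation_invariant (v e)" and A: "A \<in> SO"
  shows "colombeau_compose (abs_colombeau v) A = abs_colombeau v"
proof (cases "CARD('n) = 1")
  case True
  have "colombeau_compose (abs_colombeau v) A = abs_colombeau (\<lambda>e x. v e (mat 1 *v x))"
  proof (rule colombeau_compose_abs[OF A v])
    show "A $ i $ j = abs_gen_real (\<lambda>e. mat 1 $ i $ j)" for i j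
      by (simp add: SO_card_1[OF True A] mat_def one_gen_real.abs_eq zero_gen_real.abs_eq)
  qed simp
  then show ?thesis by simp
next
  case False
  moreover have "CARD('n) > 0" by simp
  ultimately have n: "2 \<le> CARD('n)" by linarith
  define a where "a e = map_matrix (\<lambda>r. rep_gen_real r e) A" for e
  have m: "(\<lambda>e. a e $ i $ j) \<in> moderate_real" for i j
    by (simp add: a_def rep_gen_real_moderate)
  have Aa: "A $ i $ j = abs_gen_real (\<lambda>e. a e $ i $ j)" for i j
    by (simp add: a_def abs_rep_gen_real)
  have "loc_bounded a"
    unfolding loc_bounded_def by (rule SO_entries_bounded[OF A m Aa])
  then have "(\<lambda>e x. v e (a e *v x)) \<in> moderate_nets"
    by (intro moderate_nets_compose m v)
  moreover have "loc_negligible (\<lambda>e x. v e (a e *v x) - v e x)"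
    using inv by (intro loc_negligible_invariant_compose[OF A m Aa n v]) auto
  ultimately have "abs_colombeau (\<lambda>e x. v e (a e *v x)) = abs_colombeau v"
    using v by (simp add: abs_colombeau_eq_iff negligible_nets_iff moderate_nets_diff)
  then show ?thesis
    by (simp add: colombeau_compose_abs[OF A v m Aa])
qed

theorem theorem7p6:
  fixes u :: "'n::finite colombeau"
  shows "((\<forall>A \<in> (SO :: (gen_real^'n^'n) set). colombeau_compose u A = u) \<longleftrightarrow>
          (\<forall>A \<in> (SO :: (real^'n^'n) set). colombeau_compose u (map_matrix of_real A) = u)) \<and>
         ((\<forall>A \<in> (SO :: (real^'n^'n) set). colombeau_compose u (map_matrix of_real A) = u) \<longleftrightarrow>
          (\<forall>\<xi> \<in> rotation_generators. colombeau_vf_deriv \<xi> u = 0)) \<and>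
         ((\<forall>\<xi> \<in> rotation_generators. colombeau_vf_deriv \<xi> u = 0) \<longleftrightarrow>
          (\<exists>v \<in> moderate_nets. abs_colombeau v = u \<and> (\<forall>\<epsilon>\<in>{0<..1}. rotation_invariant (v \<epsilon>))))"
  (is "(?i \<longleftrightarrow> ?i') \<and> (?i' \<longleftrightarrow> ?ii) \<and> (?ii \<longleftrightarrow> ?iii)")
proof -
  \<comment> \<open>The four implications form a cycle. Standard rotations suffice because an
    invariant representative leads back to all generalized rotations.\<close>
  have "?i \<Longrightarrow> ?i'" using SO_of_real by blast
  moreover have "?i' \<Longrightarrow> ?ii" using compose_invariant_imp_vf_deriv_0 by blast
  moreover have "?ii \<Longrightarrow> ?iii" by (rule vf_deriv_0_imp_invariant_representative)
  moreover have "?iii \<Longrightarrow> ?i" using invariant_representative_imp_compose by blast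
  ultimately show ?thesis by blast
qed

end
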